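(* Let $(V,g)$ be an oriented Euclidean real vector space of dimension $n$, let $0\le p\le n$, and let $\omega\in\mathcal C_1^p$ be decomposed as $\omega=\sum_{i=0}^pg^{p-i}\omega_i$ with $\omega_i\in E_1^i$. Then $$*\omega=\sum_{i=0}^{\min\{p,n-p\}}(-1)^i\frac{(p-i)!}{(n-p-i)!}\,g^{n-p-i}\omega_i .$$ In particular, if $n=2p$, then $*\omega=\sum_{i=0}^p(-1)^ig^{p-i}\omega_i$.
   Context: $D^{p,q}=\Lambda^pV^*\otimes\Lambda^qV^*$, identified with bilinear forms $\Lambda^pV\times\Lambda^qV\to\mathbb R$. The product is $(\theta_1\otimes\theta_2)\cdot(\theta_3\otimes\theta_4)=(\theta_1\wedge\theta_3)\otimes(\theta_2\wedge\theta_4)$, and $g=\sum_{i=1}^n e_i\otimes e_i\in D^{1,1}$ for an orthonormal basis $(e_i)$ of $V^*$. The contraction $c:D^{p,q}\to D^{p-1,q-1}$ is $c\omega(x_1\wedge\dots\wedge x_{p-1},y_1\wedge\dots\wedge y_{q-1})=\sum_{j=1}^n\omega(e_j\wedge x_1\wedge\dots,e_j\wedge y_1\wedge\dots)$ with $(e_j)$ an orthonormal basis of $V$ ($c\omega=0$ if $p=0$ or $q=0$). The Hodge star $*:D^{p,q}\to D^{n-p,n-q}$ is $*(\theta_1\otimes\theta_2)=*\theta_1\otimes*\theta_2$. The first Bianchi sum $\mathcal B:D^{p,q}\to D^{p+1,q-1}$ is $\mathcal B\omega(x_1\wedge\dots\wedge x_{p+1},y_1\wedge\dots\wedge y_{q-1})=\sum_{j=1}^{p+1}(-1)^j\omega(x_1\wedge\dots\wedge\hat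 x_j\wedge\dots\wedge x_{p+1},x_j\wedge y_1\wedge\dots\wedge y_{q-1})$ ($\mathcal B\omega=0$ if $q=0$). $\mathcal C_1^p$ is the space of symmetric $\omega\in D^{p,p}$ with $\mathcal B\omega=0$, and $E_1^i=\{\eta\in\mathcal C_1^i: c\eta=0\}$ is the space of effective elements of $\mathcal C_1^i$. *)

theory Defs
  imports "HOL-Analysis.Linear_Algebra"
begin

text \<open>
  The Euclidean space \<open>V\<close> is a type of class \<open>real_inner\<close> together with an orthonormal basis, given
  as a list; its length is the dimension (which may be \<open>0\<close>).  An element of \<open>\<Lambda>\<^sup>pV\<^sup>*\<close> is identified
  with an alternating \<open>p\<close>-linear form, the wedge of covectors being normalised by
  \<open>(\<theta>\<^sub>1 \<and> \<dots> \<and> \<theta>\<^sub>p)(x\<^sub>1, \<dots>, x\<^sub>p) = det (\<theta>\<^sub>i x\<^sub>j)\<close>.  The arguments form a list, and a \<open>p\<close>-form is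
  extended by \<open>0\<close> to lists of any other length.  Thanks to this extension none of the operations
  below needs the degrees as parameters.
\<close>

definition orthonormal_basis :: "'a::real_inner list \<Rightarrow> bool" where
  "orthonormal_basis es \<longleftrightarrow>
     (\<forall>i<length es. \<forall>j<length es. es ! i \<bullet> es ! j = (if i = j then 1 else 0)) \<and>
     span (set es) = UNIV"

type_synonym 'a form = "'a list \<Rightarrow> real"

type_synonym 'a dform = "'a list \<Rightarrow> 'a list \<Rightarrow> real"

definition alt_form :: "nat \<Rightarrow> 'a::real_vector form \<Rightarrow> bool" where
  "alt_form p \<theta> \<longleftrightarrow>
     (\<forall>xs. length xs \<noteq> p \<longrightarrow> \<theta> xs = 0) \<and>
     (\<forall>xs i. length xs = p \<longrightarrow> i < p \<longrightarrow> linear (\<lambda>v. \<theta> (xs[i := v]))) \<and>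
     (\<forall>xs i j. length xs = p \<longrightarrow> i < j \<longrightarrow> j < p \<longrightarrow> xs ! i = xs ! j \<longrightarrow> \<theta> xs = 0)"

text \<open>
  For \<open>n \<ge> 1\<close> the two orientations of \<open>V\<close> correspond to the two top-degree forms with value
  \<open>\<plusminus>1\<close> on an orthonormal basis; an orientation is given by such a form.
\<close>

definition volume_form :: "'a::real_inner list \<Rightarrow> 'a form \<Rightarrow> bool" where
  "volume_form es vol \<longleftrightarrow> alt_form (length es) vol \<and> \<bar>vol es\<bar> = 1"

definition double_forms :: "nat \<Rightarrow> nat \<Rightarrow> 'a::real_vector dform set" where
  "double_forms p q = {\<omega>. (\<forall>ys. alt_form p (\<lambda>xs. \<omega> xs ys)) \<and> (\<forall>xs. alt_form q (\<omega> xs))}"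

definition tensor :: "'a form \<Rightarrow> 'a form \<Rightarrow> 'a dform" where
  "tensor \<theta> \<eta> = (\<lambda>xs ys. \<theta> xs * \<eta> ys)"

text \<open>
  \<open>shuffle_sign S\<close> is the sign of the permutation that moves the positions in \<open>S\<close> in front of all
  others and otherwise keeps the order.  The wedge product is written as a sum over shuffles;
  summands in which the sublists do not have the right lengths vanish.
\<close>

definition shuffle_sign :: "nat set \<Rightarrow> real" where
  "shuffle_sign S = (-1) ^ card {(i, j). i \<in> S \<and> j \<notin> S \<and> j < i}"

definition wedge :: "'a form \<Rightarrow> 'a form \<Rightarrow> 'a form" where
  "wedge \<theta> \<eta> = (\<lambda>xs. \<Sum>S\<in>Pow {..<length xs}.
     shuffle_sign S * \<theta> (nths xs S) * \<eta> (nths xs (- S)))"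

text \<open>
  The product of double forms is the bilinear extension of
  \<open>(\<theta>\<^sub>1 \<otimes> \<theta>\<^sub>2) \<cdot> (\<theta>\<^sub>3 \<otimes> \<theta>\<^sub>4) = (\<theta>\<^sub>1 \<and> \<theta>\<^sub>3) \<otimes> (\<theta>\<^sub>2 \<and> \<theta>\<^sub>4)\<close>; see \<open>dmult_tensor\<close>.
\<close>

definition dmult :: "'a dform \<Rightarrow> 'a dform \<Rightarrow> 'a dform" where
  "dmult \<alpha> \<beta> = (\<lambda>xs ys. \<Sum>S\<in>Pow {..<length xs}. \<Sum>T\<in>Pow {..<length ys}.
     shuffle_sign S * shuffle_sign T *
     \<alpha> (nths xs S) (nths ys T) * \<beta> (nths xs (- S)) (nths ys (- T)))"

lemma dmult_tensor:
  "dmult (tensor \<theta>1 \<theta>2) (tensor \<theta>3 \<theta>4) = tensor (wedge \<theta>1 \<theta>3) (wedge \<theta>2 \<theta>4)"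
  by (intro ext) (simp add: dmult_def tensor_def wedge_def sum_product mult_ac)

definition dunit :: "'a dform" where
  "dunit = (\<lambda>xs ys. if xs = [] \<and> ys = [] then 1 else 0)"

primrec dpower :: "'a dform \<Rightarrow> nat \<Rightarrow> 'a dform" where
  "dpower \<alpha> 0 = dunit"
| "dpower \<alpha> (Suc k) = dmult \<alpha> (dpower \<alpha> k)"

definition covector :: "'a::real_inner \<Rightarrow> 'a form" where
  "covector v = (\<lambda>xs. if length xs = 1 then v \<bullet> hd xs else 0)"

definition metric :: "'a::real_inner list \<Rightarrow> 'a dform" where
  "metric es = (\<lambda>xs ys. \<Sum>i<length es. tensor (covector (es ! i)) (covector (es ! i)) xs ys)"

definition contraction :: "'a list \<Rightarrow> 'a dform \<Rightarrow> 'a dform" where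
  "contraction es \<omega> = (\<lambda>xs ys. \<Sum>j<length es. \<omega> (es ! j # xs) (es ! j # ys))"

text \<open>
  The Hodge star is determined by \<open>\<alpha> \<and> *\<theta> = \<langle>\<alpha>, \<theta>\<rangle> vol\<close>, where \<open>\<langle>\<cdot>, \<cdot>\<rangle>\<close> makes the increasing
  wedge products of basis covectors orthonormal.  Explicitly, \<open>*\<theta> = \<Sum>\<^sub>S \<theta>(e\<^sub>S) vol(e\<^sub>S, \<dots>)\<close>, where
  \<open>e\<^sub>S\<close> is the increasing sequence of the basis vectors with index in \<open>S\<close>.
\<close>

definition hodge :: "'a list \<Rightarrow> 'a form \<Rightarrow> 'a form \<Rightarrow> 'a form" where
  "hodge es vol \<theta> = (\<lambda>xs. \<Sum>S\<in>Pow {..<length es}. \<theta> (nths es S) * vol (nths es S @ xs))"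

text \<open>The bilinear extension of \<open>*(\<theta> \<otimes> \<eta>) = *\<theta> \<otimes> *\<eta>\<close>; see \<open>dhodge_tensor\<close>.\<close>

definition dhodge :: "'a list \<Rightarrow> 'a form \<Rightarrow> 'a dform \<Rightarrow> 'a dform" where
  "dhodge es vol \<omega> = (\<lambda>xs ys. hodge es vol (\<lambda>us. hodge es vol (\<omega> us) ys) xs)"

lemma dhodge_tensor:
  "dhodge es vol (tensor \<theta> \<eta>) = tensor (hodge es vol \<theta>) (hodge es vol \<eta>)"
  by (intro ext)
    (simp add: dhodge_def tensor_def hodge_def sum_product sum_distrib_left sum_distrib_right mult_ac)

text \<open>The index \<open>j\<close> starts at \<open>0\<close>, hence the exponent \<open>Suc j\<close>.\<close>

definition bianchi :: "'a dform \<Rightarrow> 'a dform" where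
  "bianchi \<omega> = (\<lambda>xs ys. \<Sum>j<length xs.
     (-1) ^ Suc j * \<omega> (take j xs @ drop (Suc j) xs) (xs ! j # ys))"

text \<open>These are the spaces \<open>\<C>\<^sub>1\<^sup>p\<close> and \<open>E\<^sub>1\<^sup>p\<close>.\<close>

definition bianchi_forms :: "nat \<Rightarrow> 'a::real_vector dform set" where
  "bianchi_forms p = {\<omega> \<in> double_forms p p.
     (\<forall>xs ys. \<omega> xs ys = \<omega> ys xs) \<and> bianchi \<omega> = (\<lambda>xs ys. 0)}"

definition effective_forms :: "'a::real_inner list \<Rightarrow> nat \<Rightarrow> 'a dform set" where
  "effective_forms es p = {\<eta> \<in> bianchi_forms p. contraction es \<eta> = (\<lambda>xs ys. 0)}"

end

theory Submission
  imports Defs "HOL-Combinatorics.Permutations"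
begin

text \<open>
  Both sides of the formula are alternating in each group of arguments, so they are compared on
  increasing sequences of basis vectors, indexed by sets \<open>S\<close> and \<open>T\<close>.  There, multiplying an effective
  \<open>\<eta>\<close> by \<open>g\<^sup>k\<close> gives \<open>k!\<close> times the signed sum of the values of \<open>\<eta>\<close> at \<open>(S - U, T - U)\<close> over the
  \<open>k\<close>-element subsets \<open>U\<close> of \<open>S \<inter> T\<close>, while the Hodge star replaces \<open>S\<close> and \<open>T\<close> by their complements.
  Thus both sides are sums of the values of \<open>\<eta>\<close> at \<open>(D1 \<union> Z, D2 \<union> Z)\<close>, where \<open>D1\<close>, \<open>D2\<close> are the two
  differences of \<open>S\<close> and \<open>T\<close>, up to exchanging \<open>D1\<close> and \<open>D2\<close> by symmetry, and \<open>Z\<close> ranges over the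
  subsets of fixed size of \<open>S \<inter> T\<close> or of the complement of \<open>S \<union> T\<close>.  Since \<open>\<eta>\<close> is trace free, the
  elements of \<open>Z\<close> can be moved from one of these sets to the other at the cost of a sign each.
\<close>

section \<open>Inversions\<close>

text \<open>For disjoint \<open>A\<close> and \<open>B\<close> the parity is that of sorting the
  indices of \<open>A\<close> followed by those of \<open>B\<close>. The sets may also overlap,
  which yields the sign attached to a pair of index sets, and \<open>B\<close> may be infinite, such
  as the complement \<open>- S\<close>.\<close>

definition inversions :: "nat set \<Rightarrow> nat set \<Rightarrow> nat" where
  "inversions A B = card {(a, b). a \<in> A \<and> b \<in> B \<and> b < a}"

lemma finite_inversions: "finite A \<Longrightarrow> finite {(a, b). a \<in> A \<and> b \<in> B \<and> b < (a::nat)}"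
  by (rule finite_subset[of _ "Sigma A lessThan"]) auto

lemma shuffle_sign_inversions: "shuffle_sign S = (-1) ^ inversions S (- S)"
  by (simp add: shuffle_sign_def inversions_def)

lemma inversions_Un_left:
  assumes "finite A" "finite A'" "A \<inter> A' = {}"
  shows "inversions (A \<union> A') B = inversions A B + inversions A' B"
proof -
  have "{(a, b). a \<in> A \<union> A' \<and> b \<in> B \<and> b < a} =
      {(a, b). a \<in> A \<and> b \<in> B \<and> b < a} \<union> {(a, b). a \<in> A' \<and> b \<in> B \<and> b < a}"
    by auto
  then show ?thesis
    unfolding inversions_def using assms
    by (simp only:) (rule card_Un_disjoint, auto intro!: finite_inversions)
qed

lemma inversions_Un_right:
  assumes "finite A" "B \<inter> B' = {}"
  shows "inversions A (B \<union> B') = inversions A B + inversions A B'"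
proof -
  have "{(a, b). a \<in> A \<and> b \<in> B \<union> B' \<and> b < a} =
      {(a, b). a \<in> A \<and> b \<in> B \<and> b < a} \<union> {(a, b). a \<in> A \<and> b \<in> B' \<and> b < a}"
    by auto
  then show ?thesis
    unfolding inversions_def using assms
    by (simp only:) (rule card_Un_disjoint, auto intro!: finite_inversions)
qed

text \<open>The pairs in \<open>A \<times> B\<close> split into those with \<open>b < a\<close>,
  those with \<open>a < b\<close> and the diagonal.\<close>

lemma inversions_commute:
  assumes "finite A" "finite B"
  shows "inversions A B + inversions B A + card (A \<inter> B) = card A * card B"
proof -
  let ?L = "{(a, b). a \<in> A \<and> b \<in> B \<and> b < a}"
  let ?R = "{(b, a). b \<in> B \<and> a \<in> A \<and> a < b}"
  have split: "A \<times> B = ?L \<union> (prod.swap ` ?R \<union> (\<lambda>a. (a, a)) ` (A \<inter> B))"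
    by (auto simp: image_iff)
  have "card (A \<times> B) = card ?L + card (prod.swap ` ?R \<union> (\<lambda>a. (a, a)) ` (A \<inter> B))"
    unfolding split using assms by (intro card_Un_disjoint) (auto intro: finite_inversions)
  also have "card (prod.swap ` ?R \<union> (\<lambda>a. (a, a)) ` (A \<inter> B)) =
      card (prod.swap ` ?R) + card ((\<lambda>a. (a, a)) ` (A \<inter> B))"
    using assms by (intro card_Un_disjoint) (auto intro: finite_inversions)
  also have "card (prod.swap ` ?R) = card ?R"
    by (intro card_image) (auto simp: inj_on_def)
  also have "card ((\<lambda>a. (a, a)) ` (A \<inter> B)) = card (A \<inter> B)"
    by (intro card_image) (auto simp: inj_on_def)
  finally show ?thesis
    by (simp add: inversions_def card_cartesian_product)
qed

lemma inversions_self: "finite A \<Longrightarrow> inversions A A = card A choose 2"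
  using inversions_commute[of A A] by (cases "card A") (simp_all add: choose_two)

lemma inversions_Suc: "inversions (Suc ` A) (Suc ` B) = inversions A B"
proof -
  have "{(a, b). a \<in> Suc ` A \<and> b \<in> Suc ` B \<and> b < a} =
      map_prod Suc Suc ` {(a, b). a \<in> A \<and> b \<in> B \<and> b < a}"
    by (auto simp: image_iff)
  then show ?thesis
    unfolding inversions_def by (simp only:) (intro card_image, auto simp: inj_on_def)
qed

lemma inversions_insert_0_left: "inversions (insert 0 A) B = inversions A B"
  unfolding inversions_def by (rule arg_cong[where f = card]) auto

lemma inversions_insert_0_right:
  assumes "finite A" "0 \<notin> A" "0 \<notin> B"
  shows "inversions A (insert 0 B) = inversions A B + card A"
proof -
  have "{(a, b). a \<in> A \<and> b \<in> {0} \<and> b < a} = (\<lambda>a. (a, 0)) ` A"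
    using assms by (auto simp: image_iff) (metis gr0I)
  then have "inversions A {0} = card A"
    unfolding inversions_def by (simp only:) (intro card_image, auto simp: inj_on_def)
  then show ?thesis
    using inversions_Un_right[of A B "{0}"] assms by simp
qed

lemma minus_one_power_cong:
  "even (a + b) \<Longrightarrow> (-1 :: real) ^ a = (-1) ^ b"
  by (simp add: minus_one_power_iff)

section \<open>Alternating forms\<close>

lemma alt_form_length: "alt_form p \<theta> \<Longrightarrow> length xs \<noteq> p \<Longrightarrow> \<theta> xs = 0"
  by (simp add: alt_form_def)

text \<open>When the total length differs from \<open>p\<close>, the extension by 0 makes the map
  vanish identically, so it is linear in that case too.\<close>

lemma alt_form_linear:
  assumes "alt_form p \<theta>"
  shows "linear (\<lambda>v. \<theta> (us @ v # vs))"
proof (cases "Suc (length us + length vs) = p")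
  case True
  then have "length (us @ undefined # vs) = p" "length us < p"
    by auto
  then have "linear (\<lambda>v. \<theta> ((us @ undefined # vs)[length us := v]))"
    using assms unfolding alt_form_def by blast
  then show ?thesis by simp
next
  case False
  then have "(\<lambda>v. \<theta> (us @ v # vs)) = (\<lambda>v. 0)"
    using assms by (auto simp: alt_form_def)
  then show ?thesis by (simp add: module_hom_zero)
qed

lemma alt_form_repeated:
  assumes "alt_form p \<theta>"
  shows "\<theta> (us @ x # ws @ x # vs) = 0"
proof (cases "length (us @ x # ws @ x # vs) = p")
  case True
  let ?xs = "us @ x # ws @ x # vs"
  have "?xs ! length us = ?xs ! Suc (length us + length ws)"
    by (simp add: nth_append)
  moreover have "length us < Suc (length us + length ws)" "Suc (length us + length ws) < p"
    using True by auto
  ultimately show ?thesis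
    using assms True unfolding alt_form_def by blast
qed (use assms in \<open>auto simp: alt_form_def\<close>)

text \<open>Polarisation: expand the vanishing value at the equal neighbours \<open>x + y\<close>,
  \<open>x + y\<close>.\<close>

lemma adjacent_swap:
  fixes \<theta> :: "'a::real_vector form"
  assumes lin: "\<And>us vs. linear (\<lambda>v. \<theta> (us @ v # vs))"
    and adj: "\<And>us x vs. \<theta> (us @ x # x # vs) = 0"
  shows "\<theta> (us @ x # y # vs) = - \<theta> (us @ y # x # vs)"
proof -
  have 1: "\<theta> (us @ (a + b) # c # vs) = \<theta> (us @ a # c # vs) + \<theta> (us @ b # c # vs)" for a b c
    using linear_add[OF lin[of us "c # vs"]] .
  have 2: "\<theta> (us @ c # (a + b) # vs) = \<theta> (us @ c # a # vs) + \<theta> (us @ c # b # vs)" for a b c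
    using linear_add[OF lin[of "us @ [c]" vs]] by simp
  have "\<theta> (us @ (x + y) # (x + y) # vs) = 0" by (rule adj)
  then have "\<theta> (us @ x # x # vs) + \<theta> (us @ y # x # vs) +
      (\<theta> (us @ x # y # vs) + \<theta> (us @ y # y # vs)) = 0"
    unfolding 1 2 .
  then show ?thesis
    unfolding adj by linarith
qed

text \<open>Testing the alternating property on neighbouring arguments is what makes shuffle products
  tractable: exchanging two equal neighbours does not change the sublists.\<close>

lemma alt_formI_adjacent:
  fixes \<theta> :: "'a::real_vector form"
  assumes len: "\<And>xs. length xs \<noteq> p \<Longrightarrow> \<theta> xs = 0"
    and lin: "\<And>us vs. linear (\<lambda>v. \<theta> (us @ v # vs))"
    and adj: "\<And>us x vs. \<theta> (us @ x # x # vs) = 0"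
  shows "alt_form p \<theta>"
proof -
  \<comment> \<open>Equal arguments are brought together by moving the first one past the entries
    \<open>ws\<close> in between, with one change of sign each time.\<close>
  have rep: "\<theta> (us @ x # ws @ x # vs) = 0" for us x ws vs
  proof (induction ws arbitrary: us)
    case Nil
    show ?case using adj by simp
  next
    case (Cons w ws)
    have "\<theta> (us @ x # (w # ws) @ x # vs) = - \<theta> ((us @ [w]) @ x # ws @ x # vs)"
      using adjacent_swap[OF lin adj, of us x w "ws @ x # vs"] by simp
    also have "\<dots> = 0"
      unfolding Cons by simp
    finally show ?case .
  qed
  show ?thesis
    unfolding alt_form_def
  proof (intro conjI allI impI)
    fix xs :: "'a list" and i
    assume "length xs = p" "i < p"
    then show "linear (\<lambda>v. \<theta> (xs[i := v]))"
      using lin[of "take i xs" "drop (Suc i) xs"] by (simp add: upd_conv_take_nth_drop)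
  next
    fix xs :: "'a list" and i j
    assume *: "length xs = p" "i < j" "j < p" "xs ! i = xs ! j"
    define us where "us = drop (Suc i) xs"
    have "xs = take i xs @ xs ! i # us"
      unfolding us_def using * by (intro id_take_nth_drop) auto
    moreover have "us = take (j - Suc i) us @ us ! (j - Suc i) # drop (Suc (j - Suc i)) us"
      using * by (intro id_take_nth_drop) (auto simp: us_def)
    moreover have "us ! (j - Suc i) = xs ! i"
      using * by (simp add: us_def)
    ultimately show "\<theta> xs = 0"
      using rep by metis
  qed (use len in auto)
qed

lemma alt_form_adjacent: "alt_form p \<theta> \<Longrightarrow> \<theta> (us @ x # x # vs) = 0"
  using alt_form_repeated[of p \<theta> us x "[]" vs] by simp

lemma alt_form_swap:
  assumes "alt_form p \<theta>"
  shows "\<theta> (us @ x # y # vs) = - \<theta> (us @ y # x # vs)"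
  by (rule adjacent_swap) (rule alt_form_linear[OF assms], rule alt_form_adjacent[OF assms])

lemma alt_form_move:
  assumes "alt_form p \<theta>"
  shows "\<theta> (us @ ws @ x # vs) = (-1) ^ length ws * \<theta> (us @ x # ws @ vs)"
proof (induction ws arbitrary: us)
  case (Cons w ws)
  have "\<theta> (us @ (w # ws) @ x # vs) = (-1) ^ length ws * \<theta> (us @ w # x # ws @ vs)"
    using Cons[of "us @ [w]"] by simp
  also have "\<dots> = (-1) ^ length (w # ws) * \<theta> (us @ x # (w # ws) @ vs)"
    unfolding alt_form_swap[OF assms, of us w x "ws @ vs"] by simp
  finally show ?case .
qed simp

text \<open>Absolute values suffice, since only vanishing is transferred between orderings. In each
  induction step the prefix \<open>ws\<close> absorbs the first entry of \<open>us\<close>, once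
  \<open>alt_form_move\<close> has brought its partner in \<open>vs\<close> to the front.\<close>

lemma alt_form_mset:
  assumes "alt_form p \<theta>" "mset us = mset vs"
  shows "\<bar>\<theta> (ws @ us)\<bar> = \<bar>\<theta> (ws @ vs)\<bar>"
  using assms(2)
proof (induction us arbitrary: ws vs)
  case (Cons x us)
  have "x \<in> set vs"
    using mset_eq_setD[OF Cons.prems] by auto
  then obtain a b where vs: "vs = a @ x # b"
    by (meson split_list)
  then have "mset us = mset (a @ b)"
    using Cons.prems by simp
  from Cons.IH[OF this, of "ws @ [x]"] have "\<bar>\<theta> (ws @ x # us)\<bar> = \<bar>\<theta> (ws @ x # a @ b)\<bar>"
    by simp
  also have "\<dots> = \<bar>\<theta> (ws @ a @ x # b)\<bar>"
    unfolding alt_form_move[OF assms(1), of ws a x b] by (simp add: abs_mult)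
  finally show ?case
    by (simp add: vs)
qed simp

section \<open>Linear combinations of alternating forms and fixed leading arguments\<close>

lemma alt_form_zero: "alt_form p (\<lambda>xs. 0)"
  by (rule alt_formI_adjacent) (simp_all add: module_hom_zero)

lemma alt_form_cmult:
  assumes "alt_form p \<theta>"
  shows "alt_form p (\<lambda>xs. c * \<theta> xs)"
proof (rule alt_formI_adjacent)
  show "linear (\<lambda>v. c * \<theta> (us @ v # vs))" for us vs
    using linear_compose_scale_right[OF alt_form_linear[OF assms], of c us vs] by simp
qed (simp_all add: alt_form_length[OF assms] alt_form_adjacent[OF assms])

lemma alt_form_sum:
  assumes "\<And>i. i \<in> I \<Longrightarrow> alt_form p (\<theta> i)"
  shows "alt_form p (\<lambda>xs. \<Sum>i\<in>I. \<theta> i xs)"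
proof (rule alt_formI_adjacent)
  show "linear (\<lambda>v. \<Sum>i\<in>I. \<theta> i (us @ v # vs))" for us vs
    by (rule linear_compose_sum) (use alt_form_linear[OF assms] in blast)
  show "(\<Sum>i\<in>I. \<theta> i xs) = 0" if "length xs \<noteq> p" for xs
    using that alt_form_length[OF assms] by (intro sum.neutral) blast
  show "(\<Sum>i\<in>I. \<theta> i (us @ x # x # vs)) = 0" for us x vs
    using alt_form_adjacent[OF assms] by (intro sum.neutral) blast
qed

lemma alt_form_diff:
  assumes "alt_form p \<theta>" "alt_form p \<eta>"
  shows "alt_form p (\<lambda>xs. \<theta> xs - \<eta> xs)"
proof (rule alt_formI_adjacent)
  show "linear (\<lambda>v. \<theta> (us @ v # vs) - \<eta> (us @ v # vs))" for us vs
    by (intro linear_compose_sub alt_form_linear[OF assms(1)] alt_form_linear[OF assms(2)])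
qed (simp_all add: alt_form_length[OF assms(1)] alt_form_length[OF assms(2)]
  alt_form_adjacent[OF assms(1)] alt_form_adjacent[OF assms(2)])

lemma alt_form_append:
  assumes "alt_form n \<theta>"
  shows "alt_form (n - length us) (\<lambda>xs. \<theta> (us @ xs))"
proof (cases "length us \<le> n")
  case True
  show ?thesis
  proof (rule alt_formI_adjacent)
    show "\<theta> (us @ xs) = 0" if "length xs \<noteq> n - length us" for xs
      using that True by (intro alt_form_length[OF assms]) auto
    show "linear (\<lambda>v. \<theta> (us @ vs @ v # ws))" for vs ws
      using alt_form_linear[OF assms, of "us @ vs" ws] by simp
    show "\<theta> (us @ vs @ x # x # ws) = 0" for vs x ws
      using alt_form_adjacent[OF assms, of "us @ vs"] by simp
  qed
next
  case False
  then have "(\<lambda>xs. \<theta> (us @ xs)) = (\<lambda>xs. 0)"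
    by (intro ext alt_form_length[OF assms]) auto
  then show ?thesis by (simp add: alt_form_zero)
qed

section \<open>Reduction to increasing sequences of basis vectors\<close>

lemma orthonormal_basis_distinct: "orthonormal_basis es \<Longrightarrow> distinct es"
  unfolding orthonormal_basis_def distinct_conv_nth by (metis zero_neq_one)

lemma length_nths_subset: "A \<subseteq> {..<length xs} \<Longrightarrow> length (nths xs A) = card A"
  by (auto simp: length_nths intro!: arg_cong[where f = card])

text \<open>On lists of basis vectors a repetition gives 0, and a list of length \<open>p\<close>
  without repetition is a reordering of some \<open>nths es S\<close>. Arbitrary arguments are then
  reached by linearity, one position after the other.\<close>

lemma alt_form_eq_0:
  assumes alt: "alt_form p \<theta>" and es: "distinct es" "span (set es) = UNIV"
    and zero: "\<And>S. S \<subseteq> {..<length es} \<Longrightarrow> card S = p \<Longrightarrow> \<theta> (nths es S) = 0"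
  shows "\<theta> xs = 0"
proof -
  have basis: "\<theta> us = 0" if "set us \<subseteq> set es" for us
  proof (cases "length us = p \<and> distinct us")
    case True
    define S where "S = {i. i < length es \<and> es ! i \<in> set us}"
    have "set (nths es S) = set us"
      using that unfolding set_nths S_def set_conv_nth[of es] by auto
    moreover have "distinct (nths es S)"
      using es(1) by simp
    ultimately have mset: "mset us = mset (nths es S)"
      using True set_eq_iff_mset_eq_distinct by blast
    have "S \<subseteq> {..<length es}"
      by (auto simp: S_def)
    moreover from this have "card S = p"
      using mset_eq_length[OF mset] True by (simp add: length_nths_subset)
    ultimately have "\<theta> (nths es S) = 0"
      by (rule zero)
    then show ?thesis
      using alt_form_mset[OF alt mset, of "[]"] by simp
  next
    case False
    show ?thesis
    proof (cases "distinct us")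
      case True
      then show ?thesis using False alt by (intro alt_form_length) auto
    next
      case False
      then show ?thesis
        by (metis not_distinct_decomp alt_form_repeated[OF alt] append_Cons append_Nil append_assoc)
    qed
  qed
  \<comment> \<open>The entries of \<open>us\<close> are basis vectors, those of \<open>vs\<close>
    arbitrary; the induction moves the boundary between them.\<close>
  have "\<theta> (us @ vs) = 0" if "set us \<subseteq> set es" for us vs
    using that
  proof (induction vs arbitrary: us)
    case Nil
    then show ?case by (simp add: basis)
  next
    case (Cons v vs)
    have "v \<in> span (set es)"
      by (simp add: es)
    then show ?case
    proof (rule linear_eq_0_on_span[OF alt_form_linear[OF alt], rotated])
      fix e assume "e \<in> set es"
      then show "\<theta> (us @ e # vs) = 0"
        using Cons.IH[of "us @ [e]"] Cons.prems by simp
    qed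
  qed
  from this[of "[]"] show ?thesis by simp
qed

lemma double_form_eqI:
  assumes "\<alpha> \<in> double_forms p q" "\<beta> \<in> double_forms p q"
    and es: "distinct es" "span (set es) = UNIV"
    and eq: "\<And>S T. S \<subseteq> {..<length es} \<Longrightarrow> T \<subseteq> {..<length es} \<Longrightarrow> card S = p \<Longrightarrow> card T = q \<Longrightarrow>
      \<alpha> (nths es S) (nths es T) = \<beta> (nths es S) (nths es T)"
  shows "\<alpha> = \<beta>"
proof (intro ext)
  fix xs ys
  have alt: "alt_form p (\<lambda>xs. \<alpha> xs ys - \<beta> xs ys)" "alt_form q (\<lambda>ys. \<alpha> xs ys - \<beta> xs ys)" for xs ys
    using assms(1,2) by (auto simp: double_forms_def intro: alt_form_diff)
  have "\<alpha> xs (nths es T) - \<beta> xs (nths es T) = 0" if "T \<subseteq> {..<length es}" "card T = q" for T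
    by (rule alt_form_eq_0[OF alt(1) es]) (simp add: eq that)
  from alt_form_eq_0[OF alt(2) es this] show "\<alpha> xs ys = \<beta> xs ys"
    by simp
qed

text \<open>Induction on \<open>xs\<close>, the prefix \<open>ws\<close> collecting the heads
  already placed. A head in \<open>A\<close> is in front on both sides; a head in \<open>B\<close>
  must pass all of the remaining \<open>A\<close>, and this is exactly the number of inversions that
  the index 0 adds.\<close>

lemma alt_form_nths_append:
  assumes alt: "alt_form p \<theta>"
    and "A \<inter> B = {}" "A \<subseteq> {..<length xs}" "B \<subseteq> {..<length xs}"
  shows "\<theta> (ws @ nths xs A @ nths xs B) = (-1) ^ inversions A B * \<theta> (ws @ nths xs (A \<union> B))"
  using assms(2-)
proof (induction xs arbitrary: ws A B)
  case Nil
  then show ?case by (simp add: inversions_def)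
next
  case (Cons x xs)
  define A' B' where "A' = {j. Suc j \<in> A}" and "B' = {j. Suc j \<in> B}"
  have nths: "nths (x # xs) A = (if 0 \<in> A then [x] else []) @ nths xs A'"
    "nths (x # xs) B = (if 0 \<in> B then [x] else []) @ nths xs B'"
    "nths (x # xs) (A \<union> B) = (if 0 \<in> A \<union> B then [x] else []) @ nths xs (A' \<union> B')"
    unfolding nths_Cons A'_def B'_def by (simp_all add: Collect_disj_eq)
  have sub: "A' \<inter> B' = {}" "A' \<subseteq> {..<length xs}" "B' \<subseteq> {..<length xs}"
    using Cons.prems by (auto simp: A'_def B'_def)
  note IH = Cons.IH[OF sub]
  have image: "A - {0} = Suc ` A'" "B - {0} = Suc ` B'"
    by (auto simp: A'_def B'_def image_iff) (metis not0_implies_Suc)+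
  have fin: "finite A'"
    using sub finite_subset by blast
  consider "0 \<in> A" "0 \<notin> B" | "0 \<notin> A" "0 \<in> B" | "0 \<notin> A" "0 \<notin> B"
    using Cons.prems by auto
  then show ?case
  proof cases
    case 1
    then have "A = insert 0 (Suc ` A')" "B = Suc ` B'"
      using image by auto
    then have "inversions A B = inversions A' B'"
      by (simp add: inversions_insert_0_left inversions_Suc)
    then show ?thesis
      using 1 IH[of "ws @ [x]"] by (simp add: nths)
  next
    case 2
    then have "B = insert 0 (Suc ` B')" "A = Suc ` A'"
      using image by auto
    then have inv: "inversions A B = inversions A' B' + card A'"
      using fin by (simp add: inversions_insert_0_right inversions_Suc card_image)
    have "\<theta> (ws @ nths (x # xs) A @ nths (x # xs) B) =
        (-1) ^ card A' * \<theta> ((ws @ [x]) @ nths xs A' @ nths xs B')"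
      using 2 alt_form_move[OF alt, of ws "nths xs A'" x "nths xs B'"] sub
      by (simp add: nths length_nths_subset)
    then show ?thesis
      unfolding IH using 2 by (simp add: nths inv power_add)
  next
    case 3
    then have "A = Suc ` A'" "B = Suc ` B'"
      using image by auto
    then have "inversions A B = inversions A' B'"
      by (simp add: inversions_Suc)
    then show ?thesis
      using 3 IH[of ws] by (simp add: nths)
  qed
qed

text \<open>The shuffles of a product refer to positions inside the sublist
  \<open>nths xs S\<close>. Passing to positions in \<open>xs\<close> itself turns them into subsets
  of \<open>S\<close>, with signs counting inversions inside \<open>S\<close>.\<close>

lemma sum_nths_reindex:
  assumes S: "S \<subseteq> {..<length xs}"
  shows "(\<Sum>P\<in>Pow {..<length (nths xs S)}.
      shuffle_sign P * h (nths (nths xs S) P) (nths (nths xs S) (- P))) =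
    (\<Sum>A\<in>Pow S. (-1) ^ inversions A (S - A) * h (nths xs A) (nths xs (S - A)))"
proof -
  \<comment> \<open>The rank of \<open>i\<close> in \<open>S\<close>; on \<open>S\<close> it is an
    order isomorphism onto \<open>{..<card S}\<close>.\<close>
  define r where "r i = card {i' \<in> S. i' < i}" for i
  have fin: "finite S"
    using S finite_subset by blast
  have mono: "r i < r j" if "i \<in> S" "j \<in> S" "i < j" for i j
    unfolding r_def using that fin by (intro psubset_card_mono) auto
  have mono_iff: "r i < r j \<longleftrightarrow> i < j" if "i \<in> S" "j \<in> S" for i j
    using mono[of i j] mono[of j i] that by (metis linorder_neqE_nat order_less_asym)
  have inj: "inj_on r S"
    by (rule linorder_inj_onI') (use mono in \<open>metis less_irrefl\<close>)
  have "r i < card S" if "i \<in> S" for i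
    unfolding r_def using that fin by (intro psubset_card_mono) auto
  then have "r ` S \<subseteq> {..<card S}"
    by auto
  then have image: "r ` S = {..<card S}"
    using card_image[OF inj] by (intro card_subset_eq) auto
  have bij: "bij_betw ((`) r) (Pow S) (Pow {..<card S})"
    unfolding image[symmetric] using inj by (intro bij_betw_Pow) (simp add: bij_betw_def)
  have summand: "shuffle_sign (r ` A) * h (nths (nths xs S) (r ` A)) (nths (nths xs S) (- r ` A)) =
      (-1) ^ inversions A (S - A) * h (nths xs A) (nths xs (S - A))" if "A \<in> Pow S" for A
  proof -
    have A: "A \<subseteq> S"
      using that by simp
    have mem: "r i \<in> r ` A \<longleftrightarrow> i \<in> A" if "i \<in> S" for i
      using inj A that by (meson inj_on_image_mem_iff)
    have "nths (nths xs S) P = nths xs {i \<in> S. r i \<in> P}" for P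
      unfolding nths_nths r_def by (rule arg_cong[where f = "nths xs"]) auto
    moreover have "{i \<in> S. r i \<in> r ` A} = A" "{i \<in> S. r i \<in> - r ` A} = S - A"
      using A mem by auto
    moreover have "{(i, j). i \<in> r ` A \<and> j \<in> - r ` A \<and> j < i} =
        map_prod r r ` {(i, j). i \<in> A \<and> j \<in> S - A \<and> j < i}" (is "?L = ?R")
    proof
      show "?R \<subseteq> ?L"
        using A mem mono by auto
      \<comment> \<open>The complement of the image is infinite, but a \<open>j\<close> below the
        rank \<open>r a\<close> is itself the rank of an element of \<open>S\<close>.\<close>
      show "?L \<subseteq> ?R"
      proof clarify
        fix a j assume *: "a \<in> A" "j < r a" "j \<notin> r ` A"
        then have "r a \<in> r ` S"
          using A by auto
        then have "j \<in> r ` S"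
          using * unfolding image by auto
        then obtain b where "b \<in> S" "j = r b"
          by auto
        then show "(r a, j) \<in> ?R"
          using * A mono_iff by (intro image_eqI[of _ _ "(a, b)"]) auto
      qed
    qed
    then have "inversions (r ` A) (- r ` A) = inversions A (S - A)"
      unfolding inversions_def
    proof (simp only:, intro card_image)
      have "inj_on (map_prod r r) (S \<times> S)"
        using inj by (rule map_prod_inj_on) (rule inj)
      then show "inj_on (map_prod r r) {(i, j). i \<in> A \<and> j \<in> S - A \<and> j < i}"
        by (rule inj_on_subset) (use A in auto)
    qed
    ultimately show ?thesis
      by (simp add: shuffle_sign_inversions)
  qed
  show ?thesis
    unfolding length_nths_subset[OF S] sum.reindex_bij_betw[OF bij, symmetric]
    by (rule sum.cong[OF refl summand])
qed

lemma dmult_nths: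
  assumes "S \<subseteq> {..<length xs}" "T \<subseteq> {..<length ys}"
  shows "dmult \<alpha> \<beta> (nths xs S) (nths ys T) =
    (\<Sum>A\<in>Pow S. \<Sum>B\<in>Pow T. (-1) ^ inversions A (S - A) * (-1) ^ inversions B (T - B) *
       \<alpha> (nths xs A) (nths ys B) * \<beta> (nths xs (S - A)) (nths ys (T - B)))"
proof -
  let ?h = "\<lambda>us us'. \<Sum>B\<in>Pow T. (-1) ^ inversions B (T - B) *
    (\<alpha> us (nths ys B) * \<beta> us' (nths ys (T - B)))"
  have "dmult \<alpha> \<beta> (nths xs S) (nths ys T) =
    (\<Sum>P\<in>Pow {..<length (nths xs S)}. shuffle_sign P *
      ?h (nths (nths xs S) P) (nths (nths xs S) (- P)))"
    unfolding dmult_def sum_nths_reindex[OF assms(2), symmetric, of "\<lambda>vs vs'. \<alpha> _ vs * \<beta> _ vs'"]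
    by (simp add: sum_distrib_left mult_ac)
  also have "\<dots> = (\<Sum>A\<in>Pow S. (-1) ^ inversions A (S - A) * ?h (nths xs A) (nths xs (S - A)))"
    by (rule sum_nths_reindex[OF assms(1)])
  finally show ?thesis
    by (simp add: sum_distrib_left mult_ac)
qed

section \<open>Degrees of products, powers and the Hodge star\<close>

text \<open>In each summand the position of \<open>v\<close> belongs to exactly one of the two
  sublists, so only one factor depends on \<open>v\<close>.\<close>

lemma linear_wedge:
  assumes \<theta>: "alt_form p \<theta>" and \<eta>: "alt_form q \<eta>"
  shows "linear (\<lambda>v. wedge \<theta> \<eta> (us @ v # vs))"
proof -
  have nths: "nths (us @ v # vs) S = nths us S @ (if length us \<in> S then [v] else []) @
      nths vs {j. Suc (j + length us) \<in> S}" for v S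
    by (simp add: nths_append nths_Cons)
  have "linear (\<lambda>v. shuffle_sign S * \<theta> (nths (us @ v # vs) S) * \<eta> (nths (us @ v # vs) (- S)))"
    for S
  proof (cases "length us \<in> S")
    case True
    let ?d = "shuffle_sign S * \<eta> (nths us (- S) @ nths vs {j. Suc (j + length us) \<in> - S})"
    have "linear (\<lambda>v. ?d * \<theta> (nths us S @ v # nths vs {j. Suc (j + length us) \<in> S}))"
      using linear_compose_scale_right[OF alt_form_linear[OF \<theta>], of ?d] by simp
    then show ?thesis
      unfolding nths using True by (simp add: mult_ac)
  next
    case False
    let ?d = "shuffle_sign S * \<theta> (nths us S @ nths vs {j. Suc (j + length us) \<in> S})"
    have "linear (\<lambda>v. ?d * \<eta> (nths us (- S) @ v # nths vs {j. Suc (j + length us) \<in> - S}))"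
      using linear_compose_scale_right[OF alt_form_linear[OF \<eta>], of ?d] by simp
    then show ?thesis
      unfolding nths using False by (simp add: mult_ac)
  qed
  then have "linear (\<lambda>v. \<Sum>S\<in>Pow {..<Suc (length us + length vs)}.
      shuffle_sign S * \<theta> (nths (us @ v # vs) S) * \<eta> (nths (us @ v # vs) (- S)))"
    by (intro linear_compose_sum) blast
  then show ?thesis
    by (simp add: wedge_def)
qed

text \<open>Exchanging the neighbours \<open>i\<close> and \<open>Suc i\<close> preserves the order
  of every other pair of indices, so the only change is the new inversion
  \<open>(Suc i, i)\<close>.\<close>

lemma shuffle_sign_transpose:
  assumes "finite S" "i \<in> S" "Suc i \<notin> S"
  shows "shuffle_sign (transpose i (Suc i) ` S) = - shuffle_sign S"
proof -
  let ?t = "transpose i (Suc i)"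
  let ?L = "{(a, b). a \<in> ?t ` S \<and> b \<in> - ?t ` S \<and> b < a}"
  let ?R = "{(a, b). a \<in> S \<and> b \<in> - S \<and> b < a}"
  have t_mem: "?t a \<in> ?t ` S \<longleftrightarrow> a \<in> S" for a
    by (simp add: inj_image_mem_iff)
  have t_mono: "?t b < ?t a" if "b < a" "(a, b) \<noteq> (Suc i, i)" for a b
    using that by (auto simp: transpose_def)
  have "?L = insert (Suc i, i) (map_prod ?t ?t ` ?R)"
  proof
    show "?L \<subseteq> insert (Suc i, i) (map_prod ?t ?t ` ?R)"
    proof clarify
      fix a b assume *: "a \<in> S" "b < ?t a" "b \<notin> ?t ` S" "(?t a, b) \<notin> map_prod ?t ?t ` ?R"
      then have "?t b \<notin> S"
        by (metis image_eqI transpose_involutory)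
      moreover have "\<not> ?t b < a"
        using * calculation by (auto intro!: image_eqI[of _ _ "(a, ?t b)"])
      then have "(?t a, b) = (Suc i, i)"
        using t_mono[OF *(2)] by auto
      then show "?t a = Suc i \<and> b = i"
        by simp
    qed
    show "insert (Suc i, i) (map_prod ?t ?t ` ?R) \<subseteq> ?L"
      using assms t_mem t_mem[of i] t_mem[of "Suc i"] by (auto intro!: t_mono)
  qed
  moreover have "(Suc i, i) \<notin> map_prod ?t ?t ` ?R"
    using assms by (auto simp: transpose_def split: if_splits)
  moreover have "card (map_prod ?t ?t ` ?R) = card ?R"
    by (intro card_image inj_on_subset[OF prod.inj_map]) auto
  moreover have "finite ?R"
    by (rule finite_inversions[OF assms(1)])
  ultimately show ?thesis
    unfolding shuffle_sign_inversions inversions_def by simp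
qed

lemma nths_repeated_transpose:
  fixes us :: "'a list"
  defines "i \<equiv> length us"
  assumes "i \<in> S \<longleftrightarrow> Suc i \<notin> S"
  shows "nths (us @ x # x # vs) (transpose i (Suc i) ` S) = nths (us @ x # x # vs) S"
proof -
  let ?t = "transpose i (Suc i)"
  have mem: "a \<in> ?t ` S \<longleftrightarrow> ?t a \<in> S" for a
    by (metis image_iff transpose_involutory)
  have "nths us (?t ` S) = nths us S"
    unfolding nths_def
    by (rule arg_cong[where f = "map fst"], rule filter_cong)
      (auto simp: mem i_def transpose_def in_set_zip)
  moreover have "{j. Suc (Suc (j + i)) \<in> ?t ` S} = {j. Suc (Suc (j + i)) \<in> S}"
    by (auto simp: mem transpose_def)
  moreover have "i \<in> ?t ` S \<longleftrightarrow> Suc i \<in> S" "Suc i \<in> ?t ` S \<longleftrightarrow> i \<in> S"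
    by (simp_all add: mem)
  ultimately show ?thesis
    using assms by (simp add: nths_append nths_Cons)
qed

text \<open>Exchanging the positions of two equal neighbours permutes the shuffles. If both
  positions lie in the same sublist the summand is 0; otherwise the sublists are unchanged and the
  sign flips. Hence the sum equals its own negative.\<close>

lemma alt_form_wedge:
  assumes \<theta>: "alt_form p \<theta>" and \<eta>: "alt_form q \<eta>"
  shows "alt_form (p + q) (wedge \<theta> \<eta>)"
proof (rule alt_formI_adjacent)
  fix xs :: "'a list"
  assume len: "length xs \<noteq> p + q"
  have "\<theta> (nths xs S) * \<eta> (nths xs (- S)) = 0" if "S \<subseteq> {..<length xs}" for S
  proof -
    \<comment> \<open>The infinite set \<open>- S\<close> is replaced by its finite part, so that
      lengths become cardinalities.\<close>
    have "nths xs (- S) = nths xs ({..<length xs} - S)"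
      unfolding nths_def by (rule arg_cong[where f = "map fst"], rule filter_cong) (auto simp: in_set_zip)
    then have "length (nths xs S) + length (nths xs (- S)) = card S + card ({..<length xs} - S)"
      using that by (simp add: length_nths_subset)
    also have "\<dots> = length xs"
      using that card_Diff_subset[of S "{..<length xs}"] card_mono[of "{..<length xs}" S]
      by (simp add: finite_subset)
    finally have "length (nths xs S) \<noteq> p \<or> length (nths xs (- S)) \<noteq> q"
      using len by auto
    then show ?thesis
      using alt_form_length[OF \<theta>] alt_form_length[OF \<eta>] by auto
  qed
  then show "wedge \<theta> \<eta> xs = 0"
    unfolding wedge_def mult.assoc by (intro sum.neutral) auto
next
  fix us vs :: "'a list" and x
  let ?xs = "us @ x # x # vs" and ?i = "length us"
  let ?t = "transpose ?i (Suc ?i)"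
  define f where "f S = shuffle_sign S * \<theta> (nths ?xs S) * \<eta> (nths ?xs (- S))" for S
  have bij: "bij_betw ((`) ?t) (Pow {..<length ?xs}) (Pow {..<length ?xs})"
  proof (rule bij_betw_Pow)
    have "?t permutes {..<length ?xs}"
      by (intro permutes_swap_id) auto
    then show "bij_betw ?t {..<length ?xs} {..<length ?xs}"
      by (rule permutes_imp_bij)
  qed
  have "f (?t ` S) = - f S" if "S \<in> Pow {..<length ?xs}" for S
  proof -
    have fin: "finite S"
      using that finite_subset by blast
    have nths: "nths ?xs S = nths us S @ (if ?i \<in> S then [x] else []) @
        (if Suc ?i \<in> S then [x] else []) @ nths vs {j. Suc (Suc (j + ?i)) \<in> S}" for S
      by (simp add: nths_append nths_Cons)
    have compl: "- ?t ` S = ?t ` (- S)"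
      by (simp add: bij_image_Compl_eq)
    consider "?i \<in> S" "Suc ?i \<in> S" | "?i \<notin> S" "Suc ?i \<notin> S" | "?i \<in> S \<longleftrightarrow> Suc ?i \<notin> S"
      by blast
    then show ?thesis
    proof cases
      case 1
      then have "?t ` S = S" "\<theta> (nths ?xs S) = 0"
        by (simp_all add: nths alt_form_adjacent[OF \<theta>])
      then show ?thesis by (simp add: f_def)
    next
      case 2
      then have "?t ` S = S" "\<eta> (nths ?xs (- S)) = 0"
        by (simp_all add: nths alt_form_adjacent[OF \<eta>])
      then show ?thesis by (simp add: f_def)
    next
      case 3
      then have "shuffle_sign (?t ` S) = - shuffle_sign S"
      proof (cases "?i \<in> S")
        case True
        then show ?thesis using 3 fin by (simp add: shuffle_sign_transpose)
      next
        case False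
        then have "?i \<in> ?t ` S" "Suc ?i \<notin> ?t ` S"
          using 3 by (metis image_iff transpose_apply_second transpose_involutory)+
        from shuffle_sign_transpose[OF _ this] show ?thesis
          using fin by (simp add: image_image)
      qed
      then show ?thesis
        unfolding f_def compl using 3 by (simp add: nths_repeated_transpose)
    qed
  qed
  then have "(\<Sum>S\<in>Pow {..<length ?xs}. f S) = - (\<Sum>S\<in>Pow {..<length ?xs}. f S)"
    using sum.reindex_bij_betw[OF bij, of f] by (simp add: sum_negf)
  then show "wedge \<theta> \<eta> ?xs = 0"
    unfolding wedge_def f_def by simp
qed (rule linear_wedge[OF assms])

text \<open>With one group of arguments held fixed, the product is a linear combination of ordinary
  wedge products in the other group.\<close>

lemma dmult_double_forms:
  assumes "\<alpha> \<in> double_forms p q" "\<beta> \<in> double_forms r s"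
  shows "dmult \<alpha> \<beta> \<in> double_forms (p + r) (q + s)"
proof -
  have "(\<lambda>xs. dmult \<alpha> \<beta> xs ys) = (\<lambda>xs. \<Sum>T\<in>Pow {..<length ys}. shuffle_sign T *
      wedge (\<lambda>us. \<alpha> us (nths ys T)) (\<lambda>us. \<beta> us (nths ys (- T))) xs)" for ys
    unfolding dmult_def wedge_def sum_distrib_left
    by (rule ext, subst sum.swap) (simp add: mult_ac)
  moreover have "dmult \<alpha> \<beta> xs = (\<lambda>ys. \<Sum>S\<in>Pow {..<length xs}. shuffle_sign S *
      wedge (\<alpha> (nths xs S)) (\<beta> (nths xs (- S))) ys)" for xs
    unfolding dmult_def wedge_def sum_distrib_left by (simp add: mult_ac)
  ultimately show ?thesis
    using assms unfolding double_forms_def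
    by (auto intro!: alt_form_sum alt_form_cmult alt_form_wedge)
qed

lemma dunit_double_forms: "dunit \<in> double_forms 0 0"
  unfolding double_forms_def alt_form_def dunit_def by auto

lemma alt_form_covector: "alt_form 1 (covector v)"
proof (rule alt_formI_adjacent)
  show "linear (\<lambda>w. covector v (us @ w # vs))" for us vs
  proof (cases "us = [] \<and> vs = []")
    case True
    then show ?thesis
      by (simp add: covector_def bounded_linear.linear[OF bounded_linear_inner_right])
  next
    case False
    then have "(\<lambda>w. covector v (us @ w # vs)) = (\<lambda>w. 0)"
      by (auto simp: covector_def fun_eq_iff)
    then show ?thesis by (simp add: module_hom_zero)
  qed
qed (simp_all add: covector_def)

lemma metric_double_forms: "metric es \<in> double_forms 1 1"
proof -
  have "metric es xs = (\<lambda>ys. \<Sum>i<length es. covector (es ! i) xs * covector (es ! i) ys)" for xs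
    by (simp add: metric_def tensor_def fun_eq_iff)
  moreover have "(\<lambda>xs. metric es xs ys) =
      (\<lambda>xs. \<Sum>i<length es. covector (es ! i) ys * covector (es ! i) xs)" for ys
    by (simp add: metric_def tensor_def fun_eq_iff mult.commute)
  ultimately show ?thesis
    unfolding double_forms_def by (auto intro!: alt_form_sum alt_form_cmult alt_form_covector[simplified])
qed

lemma dpower_double_forms: "\<alpha> \<in> double_forms p q \<Longrightarrow> dpower \<alpha> k \<in> double_forms (k * p) (k * q)"
  by (induction k) (auto simp: dunit_double_forms intro: dmult_double_forms)

lemma alt_form_hodge:
  assumes \<theta>: "alt_form p \<theta>" and vol: "alt_form (length es) vol"
  shows "alt_form (length es - p) (hodge es vol \<theta>)"
  unfolding hodge_def
proof (rule alt_form_sum)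
  fix S assume "S \<in> Pow {..<length es}"
  show "alt_form (length es - p) (\<lambda>xs. \<theta> (nths es S) * vol (nths es S @ xs))"
  proof (cases "length (nths es S) = p")
    case True
    then show ?thesis
      using alt_form_append[OF vol, of "nths es S"] by (intro alt_form_cmult) simp
  next
    case False
    then show ?thesis
      by (simp add: alt_form_length[OF \<theta>] alt_form_zero)
  qed
qed

lemma dhodge_double_forms:
  assumes \<omega>: "\<omega> \<in> double_forms p q" and vol: "alt_form (length es) vol"
  shows "dhodge es vol \<omega> \<in> double_forms (length es - p) (length es - q)"
proof -
  have alt: "alt_form p (\<lambda>xs. \<omega> xs ys)" "alt_form q (\<omega> xs)" for xs ys
    using \<omega> by (auto simp: double_forms_def)
  have "alt_form (length es - p) (\<lambda>xs. dhodge es vol \<omega> xs ys)" for ys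
    unfolding dhodge_def
  proof (rule alt_form_hodge[OF _ vol])
    show "alt_form p (\<lambda>us. hodge es vol (\<omega> us) ys)"
      unfolding hodge_def by (subst mult.commute) (intro alt_form_sum alt_form_cmult alt)
  qed
  moreover have "alt_form (length es - q) (dhodge es vol \<omega> xs)" for xs
    unfolding dhodge_def
    by (subst hodge_def, subst mult.commute)
      (intro alt_form_sum alt_form_cmult alt_form_hodge[OF alt(2) vol])
  ultimately show ?thesis
    by (simp add: double_forms_def)
qed

section \<open>Components with respect to the basis\<close>

lemma nths_single_index:
  assumes "j < length xs"
  shows "nths xs {j} = [xs ! j]"
proof -
  have "length (nths xs {j}) = 1"
    using assms by (simp add: length_nths_subset)
  then obtain x where "nths xs {j} = [x]"
    by (auto simp: length_Suc_conv)
  moreover have "set (nths xs {j}) = {xs ! j}"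
    using assms by (auto simp: set_nths)
  ultimately show ?thesis by simp
qed

lemma metric_nths:
  assumes es: "orthonormal_basis es" and "A \<subseteq> {..<length es}" "B \<subseteq> {..<length es}"
  shows "metric es (nths es A) (nths es B) = (if A = B \<and> card A = 1 then 1 else 0)"
proof (cases "card A = 1 \<and> card B = 1")
  case True
  then obtain a b where ab: "A = {a}" "B = {b}" "a < length es" "b < length es"
    using assms by (auto simp: card_1_singleton_iff)
  have "metric es (nths es A) (nths es B) = (\<Sum>i<length es. (es ! i \<bullet> es ! a) * (es ! i \<bullet> es ! b))"
    using ab by (simp add: metric_def tensor_def covector_def nths_single_index)
  also have "\<dots> = (\<Sum>i<length es. if i = a then (if a = b then 1 else 0) else 0)"
    using es ab by (intro sum.cong) (auto simp: orthonormal_basis_def)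
  finally show ?thesis
    using ab by (simp add: sum.delta)
next
  case False
  then have "metric es (nths es A) (nths es B) = 0"
    using assms by (auto simp: metric_def tensor_def covector_def length_nths_subset intro!: sum.neutral)
  then show ?thesis
    using False by auto
qed

text \<open>Splitting off one factor of the metric splits the same single index off \<open>A\<close>
  and off \<open>B\<close>, so the two shuffle signs agree and cancel. If \<open>A\<close> has
  \<open>Suc k\<close> elements, each of the \<open>Suc k\<close> choices contributes
  \<open>fact k\<close>.\<close>

lemma dpower_metric_nths:
  assumes es: "orthonormal_basis es" and "A \<subseteq> {..<length es}" "B \<subseteq> {..<length es}"
  shows "dpower (metric es) k (nths es A) (nths es B) = (if A = B \<and> card A = k then fact k else 0)"
  using assms(2,3)
proof (induction k arbitrary: A B)
  case 0
  then have "finite A" "finite B"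
    using finite_subset by blast+
  then have "nths es A = [] \<longleftrightarrow> A = {}" "nths es B = [] \<longleftrightarrow> B = {}"
    using 0 by (metis card_eq_0_iff length_0_conv length_nths_subset)+
  then show ?case
    using \<open>finite A\<close> by (auto simp: dunit_def)
next
  case (Suc k)
  have fin: "finite A"
    using Suc.prems finite_subset by blast
  have *: "dpower (metric es) (Suc k) (nths es A) (nths es B) =
      (\<Sum>A'\<in>Pow A. \<Sum>B'\<in>Pow B. (-1) ^ inversions A' (A - A') * (-1) ^ inversions B' (B - B') *
        (if A' = B' \<and> card A' = 1 then 1 else 0) *
        (if A - A' = B - B' \<and> card (A - A') = k then fact k else 0))"
    unfolding dpower.simps dmult_nths[OF Suc.prems]
  proof (intro sum.cong refl)
    fix A' B' assume "A' \<in> Pow A" "B' \<in> Pow B"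
    then have sub: "A' \<subseteq> {..<length es}" "B' \<subseteq> {..<length es}"
        "A - A' \<subseteq> {..<length es}" "B - B' \<subseteq> {..<length es}"
      using Suc.prems by auto
    show "(-1) ^ inversions A' (A - A') * (-1) ^ inversions B' (B - B') *
        metric es (nths es A') (nths es B') * dpower (metric es) k (nths es (A - A')) (nths es (B - B')) =
        (-1) ^ inversions A' (A - A') * (-1) ^ inversions B' (B - B') *
        (if A' = B' \<and> card A' = 1 then 1 else 0) *
        (if A - A' = B - B' \<and> card (A - A') = k then fact k else 0)"
      unfolding metric_nths[OF es sub(1,2)] Suc.IH[OF sub(3,4)] ..
  qed
  show ?case
  proof (cases "A = B")
    case True
    have "dpower (metric es) (Suc k) (nths es A) (nths es B) =
        (\<Sum>A'\<in>Pow A. \<Sum>B'\<in>Pow A. if B' = A' then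
          (if card A' = 1 \<and> card A = Suc k then fact k else 0) else 0)"
      unfolding * unfolding True[symmetric]
    proof (intro sum.cong refl)
      fix A' B' assume A': "A' \<in> Pow A"
      have "card A = Suc k \<longleftrightarrow> card (A - A') = k" if "card A' = 1"
      proof -
        have "card (A - A') = card A - 1" "card A \<ge> 1"
          using that A' fin card_Diff_subset[of A' A] card_mono[of A A'] finite_subset by auto
        then show ?thesis by linarith
      qed
      then show "(-1) ^ inversions A' (A - A') * (-1) ^ inversions B' (A - B') *
          (if A' = B' \<and> card A' = 1 then 1 else 0) *
          (if A - A' = A - B' \<and> card (A - A') = k then fact k else 0) =
        (if B' = A' then (if card A' = 1 \<and> card A = Suc k then fact k else 0) else (0::real))"
        by (auto simp flip: power_add)
    qed
    also have "\<dots> = (\<Sum>A'\<in>Pow A. if card A' = 1 then if card A = Suc k then fact k else 0 else 0)"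
      using fin by (intro sum.cong) (auto simp: sum.delta)
    also have "\<dots> = (\<Sum>A' | A' \<subseteq> A \<and> card A' = 1. if card A = Suc k then fact k else 0)"
      using fin by (subst sum.inter_filter[symmetric]) (auto intro!: sum.cong simp: Pow_def)
    also have "\<dots> = (if card A = Suc k then fact (Suc k) else 0)"
      using n_subsets[OF fin, of 1] by simp
    finally show ?thesis
      using True by simp
  next
    case False
    have "dpower (metric es) (Suc k) (nths es A) (nths es B) = 0"
      unfolding * using False by (intro sum.neutral ballI) auto
    then show ?thesis
      using False by simp
  qed
qed

text \<open>Powers of the metric are diagonal on basis sequences, so only the summands of
  \<open>dmult_nths\<close> with equal sets \<open>A\<close> and \<open>B\<close> survive.\<close>

lemma dmult_dpower_metric_nths:
  assumes es: "orthonormal_basis es" and S: "S \<subseteq> {..<length es}" and T: "T \<subseteq> {..<length es}"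
  shows "dmult (dpower (metric es) k) \<eta> (nths es S) (nths es T) =
    fact k * (\<Sum>U | U \<subseteq> S \<inter> T \<and> card U = k.
      (-1) ^ inversions U (S - U) * (-1) ^ inversions U (T - U) *
      \<eta> (nths es (S - U)) (nths es (T - U)))"
proof -
  have fin: "finite S" "finite T"
    using S T finite_subset by blast+
  let ?f = "\<lambda>U. (-1) ^ inversions U (S - U) * (-1) ^ inversions U (T - U) *
      \<eta> (nths es (S - U)) (nths es (T - U))"
  have "dmult (dpower (metric es) k) \<eta> (nths es S) (nths es T) =
    (\<Sum>A\<in>Pow S. \<Sum>B\<in>Pow T. if B = A then (if card A = k then fact k * ?f A else 0) else 0)"
    unfolding dmult_nths[OF S T] using S T
    by (intro sum.cong refl) (subst dpower_metric_nths[OF es], auto)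
  also have "\<dots> = (\<Sum>A\<in>Pow S. if A \<subseteq> T \<and> card A = k then fact k * ?f A else 0)"
    using fin by (intro sum.cong refl) (auto simp: sum.delta)
  also have "\<dots> = (\<Sum>A | A \<subseteq> S \<inter> T \<and> card A = k. fact k * ?f A)"
    using fin by (subst sum.inter_filter[symmetric]) (auto intro!: sum.cong simp: Pow_def)
  finally show ?thesis
    by (simp add: sum_distrib_left)
qed

text \<open>Expand \<open>inversions A B\<close> along \<open>U \<union> (A - U)\<close> and
  \<open>U \<union> (B - U)\<close>, then reverse the pair \<open>A - U\<close>, \<open>U\<close> by
  \<open>inversions_commute\<close>. Apart from its size, \<open>U\<close> then enters only through
  the inversions between the remainders.\<close>

lemma inversions_common_subset:
  assumes "finite A" "finite B" "U \<subseteq> A \<inter> B"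
  shows "(-1 :: real) ^ inversions U (A - U) * (-1) ^ inversions U (B - U) =
    (-1) ^ (inversions A B + inversions (A - U) (B - U) + card U * card (A - U) + (card U choose 2))"
proof -
  have fin: "finite U"
    using assms finite_subset by blast
  have "inversions A B = inversions (U \<union> (A - U)) (U \<union> (B - U))"
    using assms by (intro arg_cong2[where f = inversions]) auto
  also have "\<dots> = inversions U U + inversions U (B - U) + inversions (A - U) U +
      inversions (A - U) (B - U)"
    using fin assms by (simp add: inversions_Un_left inversions_Un_right del: Un_Diff_cancel Un_Diff_cancel2)
  finally have "inversions A B = (card U choose 2) + inversions U (B - U) + inversions (A - U) U +
      inversions (A - U) (B - U)"
    by (simp add: inversions_self[OF fin])
  moreover have "inversions U (A - U) + inversions (A - U) U = card U * card (A - U)"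
    using inversions_commute[of U "A - U"] fin assms by simp
  ultimately show ?thesis
    unfolding power_add[symmetric] by (intro minus_one_power_cong) presburger
qed

text \<open>The two signs of the Hodge star are rewritten through pairs of sets. The mixed count
  \<open>inversions (N - S) T\<close> is completed once to \<open>inversions (N - S) N\<close> and
  once to \<open>inversions N T\<close>; modulo 2 it cancels between the two.\<close>

lemma inversions_complement:
  assumes "finite N" "S \<subseteq> N" "T \<subseteq> N"
  shows "(-1 :: real) ^ inversions (N - S) S * (-1) ^ inversions (N - T) T =
    (-1) ^ (inversions (N - S) (N - T) + inversions S T +
      (card (N - S) choose 2) + (card T choose 2))"
proof -
  have fin: "finite S" "finite T"
    using assms finite_subset by blast+
  have N: "S \<union> (N - S) = N" "T \<union> (N - T) = N"
    using assms by auto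
  have "inversions (N - S) T + inversions (N - S) (N - T) = inversions (N - S) N"
    using inversions_Un_right[of "N - S" T "N - T"] assms unfolding N by simp
  also have "\<dots> = inversions (N - S) S + (card (N - S) choose 2)"
    using inversions_Un_right[of "N - S" S "N - S"] assms unfolding N by (simp add: inversions_self)
  finally have 1: "inversions (N - S) T + inversions (N - S) (N - T) =
      inversions (N - S) S + (card (N - S) choose 2)" .
  have "inversions S T + inversions (N - S) T = inversions N T"
    using inversions_Un_left[of S "N - S" T] assms fin unfolding N by simp
  also have "\<dots> = (card T choose 2) + inversions (N - T) T"
    using inversions_Un_left[of T "N - T" T] assms fin unfolding N by (simp add: inversions_self)
  finally have 2: "inversions S T + inversions (N - S) T =
      (card T choose 2) + inversions (N - T) T" .
  show ?thesis
    unfolding power_add[symmetric] using 1 2 by (intro minus_one_power_cong) presburger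
qed

text \<open>Only \<open>R = N - S\<close> contributes, where \<open>N\<close> is the full index set:
  if \<open>R\<close> meets \<open>S\<close>, a basis vector is repeated in the volume form, and any
  other disjoint \<open>R\<close> gives too few arguments.\<close>

lemma hodge_nths:
  assumes vol: "alt_form (length es) vol" and S: "S \<subseteq> {..<length es}"
  shows "hodge es vol \<theta> (nths es S) =
    (-1) ^ inversions ({..<length es} - S) S * vol es * \<theta> (nths es ({..<length es} - S))"
proof -
  let ?N = "{..<length es}"
  have vol0: "vol (nths es R @ nths es S) = 0" if R: "R \<subseteq> ?N" "R \<noteq> ?N - S" for R
  proof (cases "R \<inter> S = {}")
    case True
    have "card R + card S \<noteq> card ?N"
    proof
      assume "card R + card S = card ?N"
      then have "card (R \<union> S) = card ?N"
        using True R S by (subst card_Un_disjoint) (auto intro: finite_subset)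
      then have "R \<union> S = ?N"
        using R S by (intro card_subset_eq) auto
      then show False
        using True R by blast
    qed
    then show ?thesis
      using R S by (intro alt_form_length[OF vol]) (simp add: length_nths_subset)
  next
    case False
    then obtain j where "j \<in> R" "j \<in> S"
      by blast
    then have "es ! j \<in> set (nths es R)" "es ! j \<in> set (nths es S)"
      using S by (auto simp: set_nths)
    then obtain a b c d where "nths es R = a @ es ! j # b" "nths es S = c @ es ! j # d"
      by (meson split_list)
    then show ?thesis
      using alt_form_repeated[OF vol, of a "es ! j" "b @ c" d] by simp
  qed
  have "hodge es vol \<theta> (nths es S) =
      (\<Sum>R\<in>Pow ?N. if R = ?N - S then \<theta> (nths es (?N - S)) * vol (nths es (?N - S) @ nths es S) else 0)"
    unfolding hodge_def using vol0 by (intro sum.cong) auto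
  also have "\<dots> = \<theta> (nths es (?N - S)) * vol (nths es (?N - S) @ nths es S)"
    by (subst sum.delta) auto
  also have "vol (nths es (?N - S) @ nths es S) = (-1) ^ inversions (?N - S) S * vol es"
  proof -
    have "(?N - S) \<union> S = ?N"
      using S by auto
    then show ?thesis
      using alt_form_nths_append[OF vol, of "?N - S" S es "[]"] S by auto
  qed
  finally show ?thesis
    by (simp add: mult_ac)
qed

text \<open>The volume form enters once per group of arguments, and
  \<open>vol es * vol es = 1\<close> removes the orientation.\<close>

lemma dhodge_nths:
  assumes vol: "volume_form es vol" and "S \<subseteq> {..<length es}" "T \<subseteq> {..<length es}"
  shows "dhodge es vol \<omega> (nths es S) (nths es T) =
    (-1) ^ inversions ({..<length es} - S) S * (-1) ^ inversions ({..<length es} - T) T *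
    \<omega> (nths es ({..<length es} - S)) (nths es ({..<length es} - T))"
proof -
  have alt: "alt_form (length es) vol" and "\<bar>vol es\<bar> = 1"
    using vol by (auto simp: volume_form_def)
  then have "vol es * vol es = 1"
    by (metis abs_mult_self_eq mult_1)
  then show ?thesis
    unfolding dhodge_def hodge_nths[OF alt assms(2)] hodge_nths[OF alt assms(3)]
    by (simp add: mult_ac)
qed

lemma alt_form_Cons_nths:
  assumes alt: "alt_form p \<theta>" and "j < length es" "X \<subseteq> {..<length es}"
  shows "\<theta> (es ! j # nths es X) =
    (if j \<in> X then 0 else (-1) ^ inversions {j} X * \<theta> (nths es (insert j X)))"
proof (cases "j \<in> X")
  case True
  then have "es ! j \<in> set (nths es X)"
    using assms by (auto simp: set_nths)
  then obtain a b where "nths es X = a @ es ! j # b"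
    by (meson split_list)
  then show ?thesis
    using True alt_form_repeated[OF alt, of "[]" "es ! j" a b] by simp
next
  case False
  then show ?thesis
    using alt_form_nths_append[OF alt, of "{j}" X es "[]"] assms
    by (simp add: nths_single_index)
qed

text \<open>The sign \<open>(-1) ^ inversions X Y\<close> interleaves the two sets of indices; it turns contraction and
  multiplication by the metric into operations without signs.\<close>

lemma contraction_zero_nths:
  assumes \<eta>: "\<eta> \<in> double_forms i i" and contr: "contraction es \<eta> = (\<lambda>xs ys. 0)"
    and X: "X \<subseteq> {..<length es}" and Y: "Y \<subseteq> {..<length es}"
  shows "(\<Sum>j\<in>{..<length es} - (X \<union> Y). (-1) ^ inversions (insert j X) (insert j Y) *
    \<eta> (nths es (insert j X)) (nths es (insert j Y))) = 0" (is "(\<Sum>j\<in>?J. ?G j) = 0")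
proof -
  have alt: "alt_form i (\<lambda>xs. \<eta> xs ys)" "alt_form i (\<eta> xs)" for xs ys
    using \<eta> by (auto simp: double_forms_def)
  have fin: "finite X" "finite Y"
    using X Y finite_subset by blast+
  \<comment> \<open>The sign from \<open>inversions_common_subset\<close> with
    \<open>U = {j}\<close>. It does not depend on \<open>j\<close>, so it can be pulled out of the
    trace and cancelled.\<close>
  let ?c = "(-1) ^ (inversions X Y + card X) :: real"
  have "\<eta> (es ! j # nths es X) (es ! j # nths es Y) = (if j \<in> ?J then ?c * ?G j else 0)"
    if "j < length es" for j
  proof -
    have "\<eta> (es ! j # nths es X) (es ! j # nths es Y) = (if j \<in> ?J then
        ((-1) ^ inversions {j} X * (-1) ^ inversions {j} Y) *
        \<eta> (nths es (insert j X)) (nths es (insert j Y)) else 0)"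
      unfolding alt_form_Cons_nths[OF alt(1) that X] alt_form_Cons_nths[OF alt(2) that Y]
      using that by simp
    moreover have "(-1) ^ inversions {j} X * (-1) ^ inversions {j} Y =
        ?c * (-1) ^ inversions (insert j X) (insert j Y)" if "j \<in> ?J"
      using inversions_common_subset[of "insert j X" "insert j Y" "{j}"] that fin
      by (simp add: power_add binomial_eq_0)
    ultimately show ?thesis by simp
  qed
  then have "(\<Sum>j<length es. if j \<in> ?J then ?c * ?G j else 0) = contraction es \<eta> (nths es X) (nths es Y)"
    unfolding contraction_def by (intro sum.cong) auto
  also have "\<dots> = 0"
    by (simp add: contr)
  also have "(\<Sum>j<length es. if j \<in> ?J then ?c * ?G j else 0) = ?c * (\<Sum>j\<in>?J. ?G j)"
    unfolding sum_distrib_left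
    by (subst sum.inter_restrict[symmetric]) (auto intro!: sum.cong)
  finally show ?thesis by simp
qed

section \<open>The action on effective forms\<close>

text \<open>Double counting of pairs \<open>(A, j)\<close>: each set with \<open>Suc r\<close>
  elements arises once from each of its elements.\<close>

lemma sum_insert_subsets:
  fixes f :: "'b set \<Rightarrow> real"
  assumes "finite I"
  shows "(\<Sum>A | A \<subseteq> I \<and> card A = r. \<Sum>j\<in>I - A. f (insert j A)) =
    Suc r * (\<Sum>A | A \<subseteq> I \<and> card A = Suc r. f A)"
proof -
  have fin: "finite {A. A \<subseteq> I \<and> card A = k}" for k
    using assms by simp
  have finA: "finite A" if "A \<subseteq> I" for A
    using assms that finite_subset by blast
  have "(\<Sum>A | A \<subseteq> I \<and> card A = r. \<Sum>j\<in>I - A. f (insert j A)) =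
      (\<Sum>(A, j)\<in>Sigma {A. A \<subseteq> I \<and> card A = r} (\<lambda>A. I - A). f (insert j A))"
    using assms by (intro sum.Sigma fin) auto
  also have "\<dots> = (\<Sum>(A, j)\<in>Sigma {A. A \<subseteq> I \<and> card A = Suc r} (\<lambda>A. A). f A)"
    by (rule sum.reindex_bij_witness[of _ "\<lambda>(A, j). (A - {j}, j)" "\<lambda>(A, j). (insert j A, j)"])
      (auto simp: finA insert_absorb)
  also have "\<dots> = (\<Sum>A | A \<subseteq> I \<and> card A = Suc r. \<Sum>j\<in>A. f A)"
    using finA by (intro sum.Sigma[symmetric] fin) auto
  finally show ?thesis
    by (simp add: sum_distrib_left)
qed

text \<open>Let \<open>h r s\<close> be the sum of \<open>H\<close> over the sets with \<open>r\<close> elements in \<open>I\<close> and \<open>s\<close> elements in \<open>J\<close>.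
  Summing the hypothesis over the sets of type \<open>(r, s)\<close> yields
  \<open>(r + 1) h (r + 1) s + (s + 1) h r (s + 1) = 0\<close>.\<close>

lemma sum_subsets_transfer:
  fixes H :: "'b set \<Rightarrow> real"
  assumes fin: "finite I" "finite J" and disj: "I \<inter> J = {}"
    and zero: "\<And>Z. Z \<subseteq> I \<union> J \<Longrightarrow> (\<Sum>j\<in>(I \<union> J) - Z. H (insert j Z)) = 0"
  shows "(\<Sum>A | A \<subseteq> I \<and> card A = q. H A) = (-1) ^ q * (\<Sum>B | B \<subseteq> J \<and> card B = q. H B)"
proof -
  define h where "h r s = (\<Sum>A | A \<subseteq> I \<and> card A = r. \<Sum>B | B \<subseteq> J \<and> card B = s. H (A \<union> B))" for r s
  have step: "Suc r * h (Suc r) s + Suc s * h r (Suc s) = 0" for r s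
  proof -
    have I: "Suc r * (\<Sum>A | A \<subseteq> I \<and> card A = Suc r. H (A \<union> B)) =
        (\<Sum>A | A \<subseteq> I \<and> card A = r. \<Sum>j\<in>I - A. H (insert j (A \<union> B)))" for B
      using sum_insert_subsets[OF fin(1), where f = "\<lambda>A. H (A \<union> B)"] by (simp del: of_nat_Suc)
    have J: "Suc s * (\<Sum>B | B \<subseteq> J \<and> card B = Suc s. H (A \<union> B)) =
        (\<Sum>B | B \<subseteq> J \<and> card B = s. \<Sum>j\<in>J - B. H (insert j (A \<union> B)))" for A
      using sum_insert_subsets[OF fin(2), where f = "\<lambda>B. H (A \<union> B)"] by (simp del: of_nat_Suc)
    have "Suc r * h (Suc r) s = (\<Sum>B | B \<subseteq> J \<and> card B = s.
        Suc r * (\<Sum>A | A \<subseteq> I \<and> card A = Suc r. H (A \<union> B)))"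
      unfolding h_def by (subst sum.swap) (simp add: sum_distrib_left del: of_nat_Suc)
    also have "\<dots> = (\<Sum>B | B \<subseteq> J \<and> card B = s. \<Sum>A | A \<subseteq> I \<and> card A = r.
        \<Sum>j\<in>I - A. H (insert j (A \<union> B)))"
      unfolding I ..
    also have "\<dots> = (\<Sum>A | A \<subseteq> I \<and> card A = r. \<Sum>B | B \<subseteq> J \<and> card B = s.
        \<Sum>j\<in>I - A. H (insert j (A \<union> B)))"
      by (rule sum.swap)
    finally have 1: "Suc r * h (Suc r) s = \<dots>" .
    have 2: "Suc s * h r (Suc s) = (\<Sum>A | A \<subseteq> I \<and> card A = r. \<Sum>B | B \<subseteq> J \<and> card B = s.
        \<Sum>j\<in>J - B. H (insert j (A \<union> B)))"
      unfolding h_def J[symmetric] by (rule sum_distrib_left)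
    have "Suc r * h (Suc r) s + Suc s * h r (Suc s) =
      (\<Sum>A | A \<subseteq> I \<and> card A = r. \<Sum>B | B \<subseteq> J \<and> card B = s.
        (\<Sum>j\<in>I - A. H (insert j (A \<union> B))) + (\<Sum>j\<in>J - B. H (insert j (A \<union> B))))"
      unfolding 1 2 by (simp add: sum.distrib)
    also have "\<dots> = 0"
    proof (intro sum.neutral ballI)
      fix A B assume AB: "A \<in> {A. A \<subseteq> I \<and> card A = r}" "B \<in> {B. B \<subseteq> J \<and> card B = s}"
      then have "(I \<union> J) - (A \<union> B) = (I - A) \<union> (J - B)"
        using disj by auto
      then have "(\<Sum>j\<in>I - A. H (insert j (A \<union> B))) + (\<Sum>j\<in>J - B. H (insert j (A \<union> B))) =
          (\<Sum>j\<in>(I \<union> J) - (A \<union> B). H (insert j (A \<union> B)))"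
        using fin disj by (simp, subst sum.union_disjoint) auto
      then show "(\<Sum>j\<in>I - A. H (insert j (A \<union> B))) + (\<Sum>j\<in>J - B. H (insert j (A \<union> B))) = 0"
        using zero[of "A \<union> B"] AB by auto
    qed
    finally show ?thesis .
  qed
  \<comment> \<open>Weighted with the factorials, the recurrence only changes the sign when an
    element moves from \<open>I\<close> to \<open>J\<close>. For \<open>s = 0\<close> the factorials
    cancel.\<close>
  have "fact r * fact s * h r s = (-1) ^ r * fact (r + s) * h 0 (r + s)" for r s
  proof (induction r arbitrary: s)
    case (Suc r)
    have "fact (Suc r) * fact s * h (Suc r) s = fact r * fact s * (Suc r * h (Suc r) s)"
      by simp
    also have "Suc r * h (Suc r) s = - (Suc s * h r (Suc s))"
      using step[of r s] by linarith
    also have "fact r * fact s * - (Suc s * h r (Suc s)) = - (fact r * fact (Suc s) * h r (Suc s))"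
      by simp
    finally show ?case
      unfolding Suc by simp
  qed simp
  from this[of q 0] have "h q 0 = (-1) ^ q * h 0 q"
    by simp
  moreover have "{B. B \<subseteq> M \<and> card B = 0} = {{}}" if "finite M" for M :: "'b set"
    using that by (auto simp: card_eq_0_iff dest: finite_subset)
  ultimately show ?thesis
    using fin by (simp add: h_def)
qed

lemma sum_subsets_complement:
  assumes "finite M" "k + q = card M"
  shows "(\<Sum>U | U \<subseteq> M \<and> card U = k. f U) = (\<Sum>B | B \<subseteq> M \<and> card B = q. f (M - B))"
proof (rule sum.reindex_bij_witness[of _ "\<lambda>B. M - B" "\<lambda>U. M - U"])
  have card: "card (M - U) = card M - card U" if "U \<subseteq> M" for U
    using assms that by (intro card_Diff_subset) (auto intro: finite_subset)
  then show "M - U \<in> {B. B \<subseteq> M \<and> card B = q}" if "U \<in> {U. U \<subseteq> M \<and> card U = k}" for U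
    using that assms(2) by auto
  show "M - B \<in> {U. U \<subseteq> M \<and> card U = k}" if "B \<in> {B. B \<subseteq> M \<and> card B = q}" for B
    using that card assms(2) by auto
qed (auto simp: double_diff)

text \<open>This is the combinatorial core, with the factorials stripped off. Apart from degenerate
  sizes, both sides are a sign times the sum of \<open>H\<close> over the \<open>q\<close>-element
  subsets of \<open>S \<inter> T\<close>; it remains to compare parities.\<close>

lemma dhodge_effective_nths:
  assumes \<eta>: "\<eta> \<in> double_forms i i" and sym: "\<And>xs ys. \<eta> xs ys = \<eta> ys xs"
    and contr: "contraction es \<eta> = (\<lambda>xs ys. 0)"
    and i: "i \<le> p" "p \<le> length es"
    and S: "S \<subseteq> {..<length es}" "card S = length es - p"
    and T: "T \<subseteq> {..<length es}" "card T = length es - p"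
  defines "N \<equiv> {..<length es}"
  shows "(-1) ^ inversions (N - S) S * (-1) ^ inversions (N - T) T *
      (\<Sum>U | U \<subseteq> (N - S) \<inter> (N - T) \<and> card U = p - i.
        (-1) ^ inversions U (N - S - U) * (-1) ^ inversions U (N - T - U) *
        \<eta> (nths es (N - S - U)) (nths es (N - T - U))) =
    (if i \<le> length es - p then (-1) ^ i *
      (\<Sum>U | U \<subseteq> S \<inter> T \<and> card U = length es - p - i.
        (-1) ^ inversions U (S - U) * (-1) ^ inversions U (T - U) *
        \<eta> (nths es (S - U)) (nths es (T - U))) else 0)"
    (is "?sgn * sum ?f _ = (if _ then _ * sum ?g _ else 0)")
proof -
  define m where "m = length es - p"
  \<comment> \<open>The four blocks partition \<open>N\<close>. As \<open>S\<close> and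
    \<open>T\<close> have equal size, so have \<open>D1\<close> and \<open>D2\<close>, whence
    \<open>card I + d = m\<close> and \<open>card J + d = p\<close>.\<close>
  define I J D1 D2 where "I = S \<inter> T" and "J = (N - S) \<inter> (N - T)"
    and "D1 = S - T" and "D2 = T - S"
  define d where "d = card D1"
  have fin: "finite N" "finite S" "finite T" "finite I" "finite J" "finite D1" "finite D2"
    using S T finite_subset[of _ N] by (auto simp: N_def I_def J_def D1_def D2_def)
  have ST: "S \<subseteq> N" "T \<subseteq> N" "card S = m" "card T = m"
    using S T by (auto simp: N_def m_def)
  have cardI: "card I + d = m" "card I + card D2 = m"
    using card_Int_Diff[of S T] card_Int_Diff[of T S] ST fin
    by (auto simp: I_def d_def D1_def D2_def Int_commute)
  have cardC: "card (N - S) = p" "card (N - T) = p"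
    using ST i fin by (simp_all add: card_Diff_subset m_def) (simp_all add: N_def)
  have "(N - S) - (N - T) = D2"
    using ST by (auto simp: D2_def)
  then have "card (N - S) = card J + card D2"
    using card_Int_Diff[OF finite_Diff[OF fin(1)], of S "N - T"] unfolding J_def by simp
  then have cardJ: "card J + d = p"
    using cardC(1) cardI by linarith
  show ?thesis
  proof (cases "d \<le> i")
    \<comment> \<open>For \<open>i < d\<close> neither \<open>I\<close> nor \<open>J\<close> has
      subsets of the required size, so both sums are empty.\<close>
    case False
    have "card U \<noteq> p - i" if "U \<subseteq> J" for U
      using card_mono[OF fin(5) that] cardJ False i by linarith
    then have f: "sum ?f {U. U \<subseteq> J \<and> card U = p - i} = 0"
      by (intro sum.neutral) blast
    have "card U \<noteq> m - i" if "U \<subseteq> I" "i \<le> m" for U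
      using card_mono[OF fin(4) that(1)] cardI False that(2) by linarith
    then have g: "sum ?g {U. U \<subseteq> I \<and> card U = m - i} = 0" if "i \<le> m"
      using that by (intro sum.neutral) blast
    show ?thesis
      unfolding m_def[symmetric] I_def[symmetric] J_def[symmetric] f
      by (cases "i \<le> m") (simp_all only: g if_True if_False mult_zero_right)
  next
    case True
    \<comment> \<open>What is left after removing \<open>U\<close> has \<open>i\<close> elements, of
      which \<open>d\<close> fill \<open>D1\<close> or \<open>D2\<close>; thus \<open>q\<close> are
      free.\<close>
    define q where "q = i - d"
    \<comment> \<open>With this sign the trace condition holds without further signs, as
      \<open>sum_subsets_transfer\<close> requires.\<close>
    define H where "H Z = (-1) ^ inversions (D1 \<union> Z) (D2 \<union> Z) *
      \<eta> (nths es (D1 \<union> Z)) (nths es (D2 \<union> Z))" for Z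
    have transfer: "(\<Sum>A | A \<subseteq> I \<and> card A = q. H A) = (-1) ^ q * (\<Sum>B | B \<subseteq> J \<and> card B = q. H B)"
    proof (rule sum_subsets_transfer)
      fix Z assume Z: "Z \<subseteq> I \<union> J"
      have "(I \<union> J) - Z = {..<length es} - ((D1 \<union> Z) \<union> (D2 \<union> Z))"
        using ST by (auto simp: I_def J_def D1_def D2_def N_def)
      moreover have "D1 \<union> Z \<subseteq> {..<length es}" "D2 \<union> Z \<subseteq> {..<length es}"
        using Z ST by (auto simp: I_def J_def D1_def D2_def N_def)
      ultimately show "(\<Sum>j\<in>(I \<union> J) - Z. H (insert j Z)) = 0"
        using contraction_zero_nths[OF \<eta> contr, of "D1 \<union> Z" "D2 \<union> Z"] by (simp add: H_def)
    qed (use fin in \<open>auto simp: I_def J_def\<close>)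
    \<comment> \<open>The part of the exponent that does not depend on \<open>B\<close>. The
      summands \<open>i + q\<close> come from exchanging \<open>D1 \<union> B\<close> and
      \<open>D2 \<union> B\<close> in the inversion count, \<open>i * i\<close> having the parity of
      \<open>i\<close>.\<close>
    define c where "c = (p - i) * i + (p - i choose 2) + (p choose 2) + (m choose 2) +
      inversions S T + i + q"
    have left: "?sgn * ?f (J - B) = (-1) ^ c * H B" if B: "B \<subseteq> J" "card B = q" for B
    proof -
      have U: "N - S - (J - B) = D2 \<union> B" "N - T - (J - B) = D1 \<union> B"
        using ST B by (auto simp: J_def D1_def D2_def)
      have finB: "finite B"
        using B fin finite_subset by blast
      have cardU: "card (J - B) = p - i"
        using B fin cardJ True finB by (simp add: card_Diff_subset q_def)
      have disj: "D1 \<inter> B = {}" "D2 \<inter> B = {}"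
        using B by (auto simp: J_def D1_def D2_def)
      then have cardDB: "card (D1 \<union> B) = i" "card (D2 \<union> B) = i"
        using B fin finB cardI True by (simp_all add: card_Un_disjoint q_def flip: d_def)
      have "(D1 \<union> B) \<inter> (D2 \<union> B) = B"
        by (auto simp: D1_def D2_def)
      then have comm: "inversions (D1 \<union> B) (D2 \<union> B) + inversions (D2 \<union> B) (D1 \<union> B) + q = i * i"
        using inversions_commute[of "D1 \<union> B" "D2 \<union> B"] fin finB cardDB B by simp
      have sgnU: "(-1 :: real) ^ inversions (J - B) (D2 \<union> B) * (-1) ^ inversions (J - B) (D1 \<union> B) =
          (-1) ^ (inversions (N - S) (N - T) + inversions (D2 \<union> B) (D1 \<union> B) +
            (p - i) * i + (p - i choose 2))"
        using inversions_common_subset[of "N - S" "N - T" "J - B"] fin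
        unfolding U cardU cardDB by (simp add: J_def) blast
      have sgn: "?sgn = (-1) ^ (inversions (N - S) (N - T) + inversions S T +
          (p choose 2) + (m choose 2))"
        using inversions_complement[OF fin(1) ST(1,2)] unfolding cardC ST(3,4) .
      \<comment> \<open>Complementation has interchanged \<open>D1\<close> and \<open>D2\<close>;
        the symmetry of \<open>\<eta>\<close> restores their order.\<close>
      have "?sgn * ?f (J - B) = ?sgn * ((-1) ^ inversions (J - B) (D2 \<union> B) *
          (-1) ^ inversions (J - B) (D1 \<union> B)) * \<eta> (nths es (D1 \<union> B)) (nths es (D2 \<union> B))"
        unfolding U using sym by simp
      also have "?sgn * ((-1) ^ inversions (J - B) (D2 \<union> B) * (-1) ^ inversions (J - B) (D1 \<union> B)) =
          (-1) ^ (c + inversions (D1 \<union> B) (D2 \<union> B))"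
        unfolding sgn sgnU unfolding power_add[symmetric]
      proof (rule minus_one_power_cong)
        have "even (i * i) \<longleftrightarrow> even i"
          by simp
        then show "even (inversions (N - S) (N - T) + inversions S T + (p choose 2) + (m choose 2) +
            (inversions (N - S) (N - T) + inversions (D2 \<union> B) (D1 \<union> B) +
            (p - i) * i + (p - i choose 2)) + (c + inversions (D1 \<union> B) (D2 \<union> B)))"
          unfolding c_def comm[symmetric] by presburger
      qed
      finally show ?thesis
        by (simp add: H_def power_add)
    qed
    have "?sgn * sum ?f {U. U \<subseteq> J \<and> card U = p - i} = (\<Sum>B | B \<subseteq> J \<and> card B = q. ?sgn * ?f (J - B))"
      using cardJ True i fin
      by (subst sum_subsets_complement[where q = q]) (auto simp: q_def sum_distrib_left)
    also have "\<dots> = (-1) ^ c * (\<Sum>B | B \<subseteq> J \<and> card B = q. H B)"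
      unfolding sum_distrib_left by (intro sum.cong refl left) auto
    also have "(\<Sum>B | B \<subseteq> J \<and> card B = q. H B) = (-1) ^ q * (\<Sum>A | A \<subseteq> I \<and> card A = q. H A)"
      unfolding transfer by (simp flip: power_add mult.assoc)
    finally have LHS: "?sgn * sum ?f {U. U \<subseteq> J \<and> card U = p - i} =
      (-1) ^ (c + q) * (\<Sum>A | A \<subseteq> I \<and> card A = q. H A)"
      by (simp add: power_add)
    show ?thesis
    proof (cases "i \<le> m")
      \<comment> \<open>Here \<open>card I = m - d < q\<close>, so after the transfer to
        \<open>I\<close> nothing is left. This is what cuts off the range of summation.\<close>
      case False
      have "card A \<noteq> q" if "A \<subseteq> I" for A
        using card_mono[OF fin(4) that] cardI False True unfolding q_def by linarith
      then have "{A. A \<subseteq> I \<and> card A = q} = {}"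
        by blast
      then have "(\<Sum>A | A \<subseteq> I \<and> card A = q. H A) = 0"
        by (simp only: sum.empty)
      then show ?thesis
        using LHS False unfolding J_def m_def by simp
    next
      case im: True
      define c' where "c' = (m - i) * i + (m - i choose 2) + inversions S T"
      have right: "?g (I - A) = (-1) ^ c' * H A" if A: "A \<subseteq> I" "card A = q" for A
      proof -
        have U: "S - (I - A) = D1 \<union> A" "T - (I - A) = D2 \<union> A"
          using A by (auto simp: I_def D1_def D2_def)
        have finA: "finite A"
          using A fin finite_subset by blast
        have cardU: "card (I - A) = m - i"
          using A fin cardI True finA by (simp add: card_Diff_subset q_def)
        have "D1 \<inter> A = {}"
          using A by (auto simp: I_def D1_def)
        then have cardDA: "card (D1 \<union> A) = i"
          using A fin finA True by (simp add: card_Un_disjoint q_def flip: d_def)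
        have "(-1 :: real) ^ inversions (I - A) (D1 \<union> A) * (-1) ^ inversions (I - A) (D2 \<union> A) =
          (-1) ^ (inversions S T + inversions (D1 \<union> A) (D2 \<union> A) + (m - i) * i + (m - i choose 2))"
          using inversions_common_subset[of S T "I - A"] fin
          unfolding U cardU cardDA by (simp add: I_def) blast
        then show ?thesis
          unfolding U by (simp add: c'_def H_def power_add)
      qed
      have "sum ?g {U. U \<subseteq> I \<and> card U = m - i} = (\<Sum>A | A \<subseteq> I \<and> card A = q. ?g (I - A))"
        using cardI True im fin by (intro sum_subsets_complement) (auto simp: q_def)
      also have "\<dots> = (-1) ^ c' * (\<Sum>A | A \<subseteq> I \<and> card A = q. H A)"
        unfolding sum_distrib_left by (intro sum.cong refl right) auto
      finally have RHS: "sum ?g {U. U \<subseteq> I \<and> card U = m - i} =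
          (-1) ^ c' * (\<Sum>A | A \<subseteq> I \<and> card A = q. H A)" .
      have choose: "(x choose 2) = (x - i choose 2) + (x - i) * i + (i choose 2)" if "i \<le> x" for x
      proof -
        define y where "y = x - i"
        have "(y + i choose 2) = (y choose 2) + y * i + (i choose 2)"
          by (induction y) (simp_all add: numeral_2_eq_2)
        moreover have "y + i = x"
          using that by (simp add: y_def)
        ultimately show ?thesis
          by (simp only: y_def)
      qed
      \<comment> \<open>Here \<open>a\<close>, \<open>b\<close>, \<open>e\<close> stand for
        \<open>(p - i) * i\<close>, \<open>p - i choose 2\<close> and \<open>i choose 2\<close>, the
        primed letters for the analogues with \<open>m\<close>, and \<open>v\<close> for
        \<open>inversions S T\<close>. One \<open>q\<close> comes from the exchange and one from the
        transfer; what survives beside \<open>c'\<close> is \<open>i\<close>, the sign of the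
        theorem.\<close>
      have parity: "even ((a + b + (b + a + e) + (b' + a' + e) + v + i + q + q) +
          (i + (a' + b' + v)))" for a b a' b' e v :: nat
        by presburger
      have "(-1 :: real) ^ (c + q) = (-1) ^ (i + c')"
        unfolding c_def c'_def choose[OF i(1)] choose[OF im]
        by (intro minus_one_power_cong parity)
      then have "?sgn * sum ?f {U. U \<subseteq> J \<and> card U = p - i} =
          (-1) ^ i * sum ?g {U. U \<subseteq> I \<and> card U = m - i}"
        unfolding LHS RHS by (simp add: power_add)
      then show ?thesis
        using im unfolding J_def I_def m_def by simp
    qed
  qed
qed

lemma double_forms_cmult: "\<omega> \<in> double_forms p q \<Longrightarrow> (\<lambda>xs ys. c * \<omega> xs ys) \<in> double_forms p q"
  by (simp add: double_forms_def alt_form_cmult)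

text \<open>The metric powers on the two sides contribute the two factorials, whence their quotient.
  For \<open>i\<close> above \<open>length es - p\<close> truncated subtraction would give the
  exponent 0 instead of a vanishing term, so that case is separate.\<close>

lemma dhodge_dmult_effective:
  assumes es: "orthonormal_basis es" and vol: "volume_form es vol"
    and \<eta>: "\<eta> \<in> effective_forms es i" and i: "i \<le> p" "p \<le> length es"
  shows "dhodge es vol (dmult (dpower (metric es) (p - i)) \<eta>) =
    (if i \<le> length es - p
     then (\<lambda>xs ys. (-1) ^ i * (fact (p - i) / fact (length es - p - i)) *
       dmult (dpower (metric es) (length es - p - i)) \<eta> xs ys)
     else (\<lambda>xs ys. 0))" (is "?L = ?R")
proof (rule double_form_eqI)
  let ?m = "length es - p"
  have \<eta>_form: "\<eta> \<in> double_forms i i" and sym: "\<And>xs ys. \<eta> xs ys = \<eta> ys xs"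
    and contr: "contraction es \<eta> = (\<lambda>xs ys. 0)"
    using \<eta> by (auto simp: effective_forms_def bianchi_forms_def)
  have power: "dmult (dpower (metric es) k) \<eta> \<in> double_forms (k + i) (k + i)" for k
    using dmult_double_forms[OF dpower_double_forms[OF metric_double_forms, of es k] \<eta>_form] by simp
  show "?L \<in> double_forms ?m ?m"
    using dhodge_double_forms[OF power[of "p - i"], of es vol] i vol by (simp add: volume_form_def)
  show "?R \<in> double_forms ?m ?m"
  proof (cases "i \<le> ?m")
    case True
    then have "dmult (dpower (metric es) (?m - i)) \<eta> \<in> double_forms ?m ?m"
      using power[of "?m - i"] True by (simp only: le_add_diff_inverse2)
    then show ?thesis
      unfolding if_P[OF True] by (rule double_forms_cmult)
  next
    case False
    then show ?thesis
      by (simp add: double_forms_def alt_form_zero)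
  qed
  show "distinct es"
    by (rule orthonormal_basis_distinct[OF es])
  show "span (set es) = UNIV"
    using es by (simp add: orthonormal_basis_def)
  fix S T assume S: "S \<subseteq> {..<length es}" "card S = ?m" and T: "T \<subseteq> {..<length es}" "card T = ?m"
  let ?N = "{..<length es}"
  let ?F = "\<lambda>A B k. \<Sum>U | U \<subseteq> A \<inter> B \<and> card U = k.
      (-1) ^ inversions U (A - U) * (-1) ^ inversions U (B - U) *
      \<eta> (nths es (A - U)) (nths es (B - U))"
  have "?L (nths es S) (nths es T) = fact (p - i) *
      ((-1) ^ inversions (?N - S) S * (-1) ^ inversions (?N - T) T * ?F (?N - S) (?N - T) (p - i))"
    unfolding dhodge_nths[OF vol S(1) T(1)]
    by (subst dmult_dpower_metric_nths[OF es]) (auto simp: mult_ac)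
  also have "\<dots> = fact (p - i) * (if i \<le> ?m then (-1) ^ i * ?F S T (?m - i) else 0)"
    unfolding dhodge_effective_nths[OF \<eta>_form sym contr i S T] ..
  also have "\<dots> = ?R (nths es S) (nths es T)"
    by (simp add: dmult_dpower_metric_nths[OF es S(1) T(1)])
  finally show "?L (nths es S) (nths es T) = ?R (nths es S) (nths es T)" .
qed

section \<open>Summation over the effective components\<close>

lemma dhodge_sum:
  "dhodge es vol (\<lambda>xs ys. \<Sum>i\<in>I. \<omega>s i xs ys) = (\<lambda>xs ys. \<Sum>i\<in>I. dhodge es vol (\<omega>s i) xs ys)"
proof (intro ext)
  fix xs ys
  have hodge_sum: "hodge es vol (\<lambda>us. \<Sum>i\<in>I. \<theta> i us) zs = (\<Sum>i\<in>I. hodge es vol (\<theta> i) zs)" for \<theta> zs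
    unfolding hodge_def sum_distrib_right by (rule sum.swap)
  show "dhodge es vol (\<lambda>xs ys. \<Sum>i\<in>I. \<omega>s i xs ys) xs ys = (\<Sum>i\<in>I. dhodge es vol (\<omega>s i) xs ys)"
    unfolding dhodge_def hodge_sum ..
qed

theorem theorem4p3:
  fixes es :: "'a::real_inner list" and vol :: "'a form" and n p :: nat
    and \<omega> :: "'a dform" and \<omega>s :: "nat \<Rightarrow> 'a dform"
  assumes "orthonormal_basis es" and "length es = n"
    and "volume_form es vol"
    and "p \<le> n"
    and "\<omega> \<in> bianchi_forms p"
    and "\<And>i. i \<le> p \<Longrightarrow> \<omega>s i \<in> effective_forms es i"
    and "\<omega> = (\<lambda>xs ys. \<Sum>i=0..p. dmult (dpower (metric es) (p - i)) (\<omega>s i) xs ys)"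
  shows "dhodge es vol \<omega> = (\<lambda>xs ys. \<Sum>i=0..min p (n - p).
           (-1) ^ i * (fact (p - i) / fact (n - p - i)) *
           dmult (dpower (metric es) (n - p - i)) (\<omega>s i) xs ys)
       \<and> (n = 2 * p \<longrightarrow>
           dhodge es vol \<omega> = (\<lambda>xs ys. \<Sum>i=0..p.
             (-1) ^ i * dmult (dpower (metric es) (p - i)) (\<omega>s i) xs ys))"
proof -
  let ?r = "\<lambda>i xs ys. (-1) ^ i * (fact (p - i) / fact (n - p - i)) *
    dmult (dpower (metric es) (n - p - i)) (\<omega>s i) xs ys"
  have "dhodge es vol \<omega> xs ys = (\<Sum>i=0..min p (n - p). ?r i xs ys)" for xs ys
  proof -
    have "dhodge es vol \<omega> xs ys =
        (\<Sum>i=0..p. dhodge es vol (dmult (dpower (metric es) (p - i)) (\<omega>s i)) xs ys)"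
      unfolding assms(7) dhodge_sum ..
    \<comment> \<open>The star annihilates the terms with \<open>n - p < i\<close>, which explains
      the upper limit \<open>min p (n - p)\<close>.\<close>
    also have "\<dots> = (\<Sum>i=0..p. if i \<le> n - p then ?r i xs ys else 0)"
      using assms by (intro sum.cong refl) (auto simp: dhodge_dmult_effective)
    also have "\<dots> = (\<Sum>i=0..min p (n - p). ?r i xs ys)"
      by (rule sum.mono_neutral_cong_right) auto
    finally show ?thesis .
  qed
  then have "dhodge es vol \<omega> = (\<lambda>xs ys. \<Sum>i=0..min p (n - p). ?r i xs ys)"
    by blast
  \<comment> \<open>For \<open>n = 2 * p\<close> both \<open>n - p\<close> and the upper limit are
    \<open>p\<close>, and each quotient of factorials is 1.\<close>
  then show ?thesis
    by simp
qed

end
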